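(* Let $r\ge 1$ be an integer. The number of direct factors of non-isomorphic abelian groups of order at most $x$ whose conjugates have rank at most $r$ is asymptotic, as $x\to\infty$, to $A_r\,x\log x$, where $A_r$ is a constant that depends on $r$. That is, there is a constant $A_r$ with $$\sum_{G} d(G)\sim A_r\,x\log x\qquad (x\to\infty),$$ where $G$ runs over isomorphism classes of finite abelian groups of order at most $x$ whose conjugate $G'$ has rank at most $r$, and $d(G)$ is the number of direct factors of $G$.
   Context: Groups are considered up to isomorphism. The number $d(G)$ of direct factors of a finite abelian group $G$ is the number of ordered pairs $(H,K)$ of isomorphism classes of finite abelian groups with $G\cong H\oplus K$. The rank of a finite abelian group is its minimal number of generators. Conjugate group: for a prime $p$ and a finite abelian $p$-group $G\cong \mathbb Z/p^{a_1}\mathbb Z\oplus\cdots\oplus\mathbb Z/p^{a_r}\mathbb Z$ with $0\le a_1\le\cdots\le a_r$, the type of $G$ is the partition $\lambda=(a_1,\dots,a_r)$, and the conjugate $G'$ is the finite abelian $p$-group whose type is the conjugate (transposed) partition $\lambda'$. For a general finite abelian group, $G'$ is the direct sum of the conjugates of its $p$-primary components. *)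

theory Defs
  imports
    Complex_Main
    "HOL-Library.Landau_Symbols"
    "HOL-Computational_Algebra.Primes"
    "HOL-Algebra.Product_Groups"
begin

section \<open>Rank and conjugate of a finite abelian group\<close>

definition group_rank :: "('a, 'm) monoid_scheme \<Rightarrow> nat" where
  "group_rank G =
     (LEAST n. \<exists>S \<subseteq> carrier G. finite S \<and> card S = n \<and> generate G S = carrier G)"

text \<open>
  The group \<open>Z/p^a_1 \<oplus> \<dots> \<oplus> Z/p^a_r\<close> for the list \<open>[a_1, \<dots>, a_r]\<close>;
  the empty list gives the trivial group.
\<close>
definition abelian_p_group :: "nat \<Rightarrow> nat list \<Rightarrow> (nat \<Rightarrow> int) monoid" where
  "abelian_p_group p as =
     product_group {..<length as} (\<lambda>i. integer_mod_group (p ^ (as ! i)))"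

text \<open>
  A partition is a nondecreasing list of positive parts. Summands \<open>Z/p^0\<close> are trivial, so
  dropping zero parts does not change the group, and it makes the type unique.
\<close>
definition p_type :: "nat \<Rightarrow> ('a, 'm) monoid_scheme \<Rightarrow> nat list" where
  "p_type p G = (THE as. sorted as \<and> 0 \<notin> set as \<and> G \<cong> abelian_p_group p as)"

text \<open>
  The parts of the transposed partition are, for \<open>j = 1, \<dots>, max as\<close>, the numbers of parts
  that are at least \<open>j\<close>; they decrease with \<open>j\<close>, hence the reversal.
\<close>
definition conjugate_partition :: "nat list \<Rightarrow> nat list" where
  "conjugate_partition as =
     rev (map (\<lambda>j. card {i. i < length as \<and> j \<le> as ! i}) [1..<Suc (Max (insert 0 (set as)))])"

definition conjugate_p_group :: "nat \<Rightarrow> ('a, 'm) monoid_scheme \<Rightarrow> (nat \<Rightarrow> int) monoid" where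
  "conjugate_p_group p G = abelian_p_group p (conjugate_partition (p_type p G))"

definition primary_component :: "nat \<Rightarrow> ('a, 'm) monoid_scheme \<Rightarrow> ('a, 'm) monoid_scheme" where
  "primary_component p G =
     G\<lparr>carrier := {x \<in> carrier G. \<exists>k::nat. x [^]\<^bsub>G\<^esub> (p ^ k) = \<one>\<^bsub>G\<^esub>}\<rparr>"

definition conjugate_group :: "('a, 'm) monoid_scheme \<Rightarrow> (nat \<Rightarrow> nat \<Rightarrow> int) monoid" where
  "conjugate_group G =
     product_group {p. prime p \<and> p dvd card (carrier G)}
       (\<lambda>p. conjugate_p_group p (primary_component p G))"


section \<open>Isomorphism classes and direct factors\<close>

text \<open>
  Every finite group is isomorphic to one whose elements are natural numbers
  (lemma \<open>fin_ab_groups_complete\<close>), so isomorphism classes of finite abelian groups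
  are taken inside the type \<^typ>\<open>nat monoid\<close>.
\<close>
definition fin_ab_groups :: "nat monoid set" where
  "fin_ab_groups = {G. comm_group G \<and> finite (carrier G)}"

definition fin_ab_iso :: "(nat monoid \<times> nat monoid) set" where
  "fin_ab_iso = {(G, H). G \<in> fin_ab_groups \<and> H \<in> fin_ab_groups \<and> G \<cong> H}"

definition fin_ab_classes :: "nat monoid set set" where
  "fin_ab_classes = fin_ab_groups // fin_ab_iso"

definition class_rep :: "nat monoid set \<Rightarrow> nat monoid" where
  "class_rep C = (SOME G. G \<in> C)"

definition num_direct_factors :: "('a, 'm) monoid_scheme \<Rightarrow> nat" where
  "num_direct_factors G =
     card {(C, D). C \<in> fin_ab_classes \<and> D \<in> fin_ab_classes \<and>
                   (\<exists>H\<in>C. \<exists>K\<in>D. G \<cong> H \<times>\<times> K)}"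

lemma equiv_fin_ab_iso: "equiv fin_ab_groups fin_ab_iso"
proof (rule equivI)
  show "fin_ab_iso \<subseteq> fin_ab_groups \<times> fin_ab_groups"
    by (auto simp: fin_ab_iso_def)
  show "refl_on fin_ab_groups fin_ab_iso"
    by (auto simp: refl_on_def fin_ab_iso_def)
  show "sym fin_ab_iso"
    by (auto simp: sym_def fin_ab_iso_def fin_ab_groups_def comm_group_def intro: group.iso_sym)
  show "trans fin_ab_iso"
    by (auto simp: trans_def fin_ab_iso_def intro: iso_trans)
qed

lemma fin_ab_groups_complete:
  assumes "comm_group G" and "finite (carrier G)"
  shows "\<exists>H\<in>fin_ab_groups. G \<cong> H"
proof -
  interpret G: comm_group G by fact
  obtain f :: "'a \<Rightarrow> nat" where f: "inj_on f (carrier G)"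
    using finite_imp_inj_to_nat_seg[OF assms(2)] by auto
  define g where "g = inv_into (carrier G) f"
  define H where "H = \<lparr>carrier = f ` carrier G, monoid.mult = (\<lambda>a b. f (g a \<otimes>\<^bsub>G\<^esub> g b)),
                       one = f \<one>\<^bsub>G\<^esub>\<rparr>"
  have gf [simp]: "g (f x) = x" if "x \<in> carrier G" for x
    using f that by (simp add: g_def)
  have carrier_H: "carrier H = f ` carrier G"
    and mult_H: "\<And>x y. x \<in> carrier G \<Longrightarrow> y \<in> carrier G \<Longrightarrow> f x \<otimes>\<^bsub>H\<^esub> f y = f (x \<otimes>\<^bsub>G\<^esub> y)"
    and one_H: "\<one>\<^bsub>H\<^esub> = f \<one>\<^bsub>G\<^esub>"
    by (simp_all add: H_def)
  have "comm_group H"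
  proof (rule comm_groupI)
    fix a assume "a \<in> carrier H"
    then obtain x where x: "x \<in> carrier G" "a = f x"
      by (auto simp: carrier_H)
    then have "f (inv\<^bsub>G\<^esub> x) \<otimes>\<^bsub>H\<^esub> a = \<one>\<^bsub>H\<^esub>"
      by (simp add: mult_H one_H)
    then show "\<exists>b\<in>carrier H. b \<otimes>\<^bsub>H\<^esub> a = \<one>\<^bsub>H\<^esub>"
      using x by (auto simp: carrier_H)
    show "\<one>\<^bsub>H\<^esub> \<otimes>\<^bsub>H\<^esub> a = a"
      using x by (simp add: mult_H one_H)
  next
    fix a b assume "a \<in> carrier H" "b \<in> carrier H"
    then obtain x y where xy: "x \<in> carrier G" "a = f x" "y \<in> carrier G" "b = f y"
      by (auto simp: carrier_H)
    then show "a \<otimes>\<^bsub>H\<^esub> b \<in> carrier H"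
      by (simp add: mult_H carrier_H)
    show "a \<otimes>\<^bsub>H\<^esub> b = b \<otimes>\<^bsub>H\<^esub> a"
      using xy by (simp add: mult_H G.m_comm)
  next
    fix a b c assume "a \<in> carrier H" "b \<in> carrier H" "c \<in> carrier H"
    then obtain x y z where "x \<in> carrier G" "a = f x" "y \<in> carrier G" "b = f y"
      "z \<in> carrier G" "c = f z"
      by (auto simp: carrier_H)
    then show "a \<otimes>\<^bsub>H\<^esub> b \<otimes>\<^bsub>H\<^esub> c = a \<otimes>\<^bsub>H\<^esub> (b \<otimes>\<^bsub>H\<^esub> c)"
      by (simp add: mult_H G.m_assoc)
  qed (simp add: carrier_H one_H)
  moreover have "finite (carrier H)"
    using assms(2) by (simp add: carrier_H)
  moreover have "f \<in> iso G H"
    using f by (simp add: iso_def hom_def bij_betw_def carrier_H mult_H)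
  ultimately show ?thesis
    unfolding fin_ab_groups_def is_iso_def by blast
qed

end

(*
  Let m_{p,k} be the number of summands Z/p^k of G. The rank of G' is at most r iff every p-primary
  component of G has exponent dividing p^r, i.e. iff m_{p,k} = 0 for k > r. By the structure
  theorem such isomorphism classes correspond to r-tuples (n_1, ..., n_r) of positive integers,
  n_k being the product of all p^(m_{p,k}), and G has order n_1 n_2^2 ... n_r^r. The restriction
  passes to and from direct factors, so summing d(G) amounts to counting pairs (D, E) of restricted
  classes with |D||E| <= x, that is, 2r-tuples of positive integers in which each of the weights
  1, ..., r is used twice. The two variables of weight 1 give the Dirichlet divisor problem, with
  x log x as main term, and each variable of weight k >= 2 multiplies the constant by zeta(k),
  by dominated convergence.
*)
theory Submission
  imports Defs "HOL-Analysis.Analysis" "HOL-Real_Asymp.Real_Asymp"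
    "HOL-Algebra.Multiplicative_Group" "HOL-Combinatorics.List_Permutation"
    "HOL-Number_Theory.Number_Theory"
begin

section \<open>Counting functions of order x log x\<close>

text \<open>On the analytic side, a limit alone cannot be summed over infinitely many values of a
  new variable: Tannery's theorem asks for a majorant valid at every argument, and y ln y vanishes
  at y = 1, where the count may be positive. So each limit is first turned into a bound C y (1 + ln
  y) for all y \<ge> 1. The resulting constant is the square of zeta(2) ... zeta(r); only its
  positivity is recorded, because equivalence to A x ln x with A = 0 would force the sum to vanish
  eventually. On the algebraic side, the obstacle in the structure theorem is to show that an
  element of maximal p-power order generates a direct summand; the projection onto it is built by
  extending a homomorphism into Z/N one element at a time. Uniqueness comes from counting solutions
  of x^n = 1. For the rank of the conjugate, the number of parts at each prime matters: the Chinese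
  remainder theorem lets one generator serve all primes at once, and counting modulo a single p
  gives the matching lower bound.\<close>

text \<open>Finiteness belongs to the predicate because \<open>card\<close> of an infinite set is 0,
  which would make the limit meaningless.\<close>

definition xlogx_count :: "'a set \<Rightarrow> ('a \<Rightarrow> nat) \<Rightarrow> real \<Rightarrow> bool" where
  "xlogx_count S w c \<longleftrightarrow>
     (\<forall>a\<in>S. w a > 0) \<and> (\<forall>x::real. finite {a\<in>S. real (w a) \<le> x}) \<and>
     ((\<lambda>x. real (card {a\<in>S. real (w a) \<le> x}) / (x * ln x)) \<longlongrightarrow> c) at_top"

lemma xlogx_countD:
  assumes "xlogx_count S w c"
  shows "a \<in> S \<Longrightarrow> w a > 0" "finite {a\<in>S. real (w a) \<le> x}"
    "((\<lambda>x. real (card {a\<in>S. real (w a) \<le> x}) / (x * ln x)) \<longlongrightarrow> c) at_top"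
  using assms by (auto simp: xlogx_count_def)

lemma xlogx_count_bij:
  assumes "xlogx_count S w c" and f: "bij_betw f T S" and v: "\<And>b. b \<in> T \<Longrightarrow> v b = w (f b)"
  shows "xlogx_count T v c"
proof -
  have b: "bij_betw f {b\<in>T. real (v b) \<le> x} {a\<in>S. real (w a) \<le> x}" for x
    using f v unfolding bij_betw_def by (auto simp: inj_on_def image_iff)
  have "\<forall>b\<in>T. v b > 0"
    using assms(1) f v unfolding xlogx_count_def bij_betw_def by auto
  then show ?thesis
    using assms(1) bij_betw_same_card[OF b] bij_betw_finite[OF b]
    unfolding xlogx_count_def by auto
qed

text \<open>This is the source of the majorant for dominated convergence. The summand 1 in
  \<open>1 + ln y\<close> keeps the bound positive near y = 1.\<close>

lemma xlogx_count_bound: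
  assumes "xlogx_count S w c"
  obtains C where "C \<ge> 0"
    "\<And>y. y \<ge> 1 \<Longrightarrow> real (card {a\<in>S. real (w a) \<le> y}) \<le> C * y * (1 + ln y)"
proof -
  define T where "T = (\<lambda>y. real (card {a\<in>S. real (w a) \<le> y}))"
  have mono: "T y \<le> T z" if "y \<le> z" for y z
    unfolding T_def using xlogx_countD(2)[OF assms] that
    by (intro of_nat_mono card_mono) auto
  have "((\<lambda>x. T x / (x * ln x)) \<longlongrightarrow> c) at_top"
    using xlogx_countD(3)[OF assms] by (simp add: T_def)
  then have "\<forall>\<^sub>F x in at_top. T x / (x * ln x) < \<bar>c\<bar> + 1"
    by (rule order_tendstoD) simp
  then obtain Y0 where Y0: "\<And>x. x \<ge> Y0 \<Longrightarrow> T x / (x * ln x) < \<bar>c\<bar> + 1"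
    by (auto simp: eventually_at_top_linorder)
  \<comment> \<open>\<open>Y \<ge> 2\<close> keeps \<open>ln y\<close> positive where the limit is
    used; below \<open>Y\<close> the count is at most \<open>T Y\<close> by monotonicity, which is
    why \<open>T Y\<close> enters \<open>C\<close>.\<close>
  define Y where "Y = max Y0 2"
  define C where "C = max (\<bar>c\<bar> + 1) (T Y)"
  have C0: "C \<ge> 0" by (simp add: C_def)
  show ?thesis
  proof (rule that[of C])
    fix y :: real assume y: "y \<ge> 1"
    have ly: "ln y \<ge> 0" using y by simp
    show "real (card {a\<in>S. real (w a) \<le> y}) \<le> C * y * (1 + ln y)"
    proof (cases "y \<ge> Y")
      case True
      then have "y > 1" by (simp add: Y_def)
      then have pos: "y * ln y > 0" by simp
      have "T y / (y * ln y) \<le> C"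
        using Y0[of y] True by (auto simp: Y_def C_def)
      then have "T y \<le> C * (y * ln y)"
        using pos by (simp add: pos_divide_le_eq)
      also have "\<dots> \<le> C * y * (1 + ln y)"
        using C0 y by (simp add: algebra_simps)
      finally show ?thesis by (simp add: T_def)
    next
      case False
      then have "T y \<le> C"
        using mono[of y Y] by (simp add: C_def)
      also have "C = C * 1 * 1" by simp
      also have "\<dots> \<le> C * y * (1 + ln y)"
        using C0 y ly by (intro mult_mono) auto
      finally show ?thesis by (simp add: T_def)
    qed
  qed (rule C0)
qed

text \<open>Sorting by n = k + 1 turns the new count into the series of \<open>T (x / m k)\<close>
  with m k = (k + 1)^e. Divided by x ln x, its k-th term tends to c / m k and stays below a multiple
  of 1 / (k + 1)^2, so Tannery's theorem yields c' = c zeta(e).\<close>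

lemma xlogx_count_times_power:
  assumes S: "xlogx_count S w c" and c: "c > 0" and e: "e \<ge> 2"
  shows "\<exists>c'>0. xlogx_count (S \<times> {n. n > 0}) (\<lambda>(a, n). w a * n ^ e) c'"
proof -
  define T where "T = (\<lambda>y. real (card {a\<in>S. real (w a) \<le> y}))"
  define L where "L = (\<lambda>x::real. {q \<in> S \<times> {n. n > 0}. real ((\<lambda>(a, n). w a * n ^ e) q) \<le> x})"
  define m where "m = (\<lambda>k. real (Suc k ^ e))"
  have m1: "m k \<ge> 1" for k
    by (simp add: m_def)
  have mk: "m k \<ge> real (Suc k)" for k
  proof -
    have "Suc k ^ 1 \<le> Suc k ^ e" using e by (intro power_increasing) auto
    then show ?thesis unfolding m_def by (metis of_nat_le_iff power_one_right)
  qed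
  have wpos: "w a \<ge> 1" if "a \<in> S" for a
    using xlogx_countD(1)[OF S that] by simp
  have T0: "T y = 0" if "y < 1" for y
  proof -
    have "{a\<in>S. real (w a) \<le> y} = {}" using wpos that by force
    then show ?thesis by (simp only: T_def card.empty of_nat_0)
  qed
  \<comment> \<open>Since every weight is at least 1 and \<open>m k \<ge> k + 1\<close>, only k < N
    can contribute once \<open>N \<ge> x\<close>; for each fixed x the series is therefore a finite
    sum.\<close>
  have Lsub: "L x = (\<Union>k<N. (\<lambda>a. (a, Suc k)) ` {a\<in>S. real (w a) \<le> x / m k})"
    if N: "real N \<ge> x" for x N
  proof (intro equalityI subsetI)
    fix q assume "q \<in> L x"
    then obtain a n where q: "q = (a, n)" "a \<in> S" "n > 0" "real (w a * n ^ e) \<le> x"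
      by (auto simp: L_def)
    obtain k where k: "n = Suc k" using q(3) gr0_implies_Suc by blast
    have le: "real (w a) * m k \<le> x" using q(4) k by (simp add: m_def)
    have "1 * m k \<le> real (w a) * m k"
      using wpos[OF q(2)] m1[of k] by (intro mult_right_mono) auto
    with le mk[of k] N have "k < N" by linarith
    moreover have "real (w a) \<le> x / m k" using le m1[of k] by (simp add: pos_le_divide_eq)
    ultimately show "q \<in> (\<Union>k<N. (\<lambda>a. (a, Suc k)) ` {a\<in>S. real (w a) \<le> x / m k})"
      using q k by auto
  next
    fix q assume "q \<in> (\<Union>k<N. (\<lambda>a. (a, Suc k)) ` {a\<in>S. real (w a) \<le> x / m k})"
    then obtain k a where q: "q = (a, Suc k)" "a \<in> S" "real (w a) \<le> x / m k" by auto
    then have "real (w a) * m k \<le> x" using m1[of k] by (simp add: pos_le_divide_eq)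
    then show "q \<in> L x" using q by (auto simp: L_def m_def)
  qed
  have fin: "finite (L x)" for x
  proof -
    obtain N where N: "real N \<ge> x" using real_arch_simple by blast
    show ?thesis unfolding Lsub[OF N]
      by (intro finite_UN_I finite_imageI xlogx_countD(2)[OF S]) auto
  qed
  have cardL: "real (card (L x)) = (\<Sum>k. T (x / m k))" for x
  proof -
    obtain N where N: "real N \<ge> x" using real_arch_simple by blast
    have "card (L x) = (\<Sum>k<N. card ((\<lambda>a. (a, Suc k)) ` {a\<in>S. real (w a) \<le> x / m k}))"
      unfolding Lsub[OF N]
      by (rule card_UN_disjoint) (auto intro!: finite_imageI xlogx_countD(2)[OF S])
    also have "\<dots> = (\<Sum>k<N. card {a\<in>S. real (w a) \<le> x / m k})"
      by (intro sum.cong refl card_image) (auto simp: inj_on_def)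
    finally have "real (card (L x)) = (\<Sum>k<N. T (x / m k))"
      by (simp add: T_def)
    also have "\<dots> = (\<Sum>k. T (x / m k))"
    proof (rule suminf_finite[symmetric])
      fix k assume "k \<notin> {..<N}"
      then have "x < m k" using N mk[of k] by simp
      then show "T (x / m k) = 0" using T0 m1[of k] by (simp add: field_simps)
    qed simp
    finally show ?thesis .
  qed
  obtain C where C: "C \<ge> 0" "\<And>y. y \<ge> 1 \<Longrightarrow> T y \<le> C * y * (1 + ln y)"
    using xlogx_count_bound[OF S] unfolding T_def by metis
  have lim: "((\<lambda>x. T (x / m k) / (x * ln x)) \<longlongrightarrow> c / m k) at_top" for k
  proof -
    have mpos: "m k > 0" using m1[of k] by linarith
    have "filterlim (\<lambda>x. x / m k) at_top at_top"
      using mpos by real_asymp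
    then have "((\<lambda>x. T (x / m k) / ((x / m k) * ln (x / m k))) \<longlongrightarrow> c) at_top"
      using xlogx_countD(3)[OF S] unfolding T_def by (rule filterlim_compose[rotated])
    moreover have "((\<lambda>x. ((x / m k) * ln (x / m k)) / (x * ln x)) \<longlongrightarrow> 1 / m k) at_top"
      using mpos by (real_asymp simp: field_simps)
    ultimately have "((\<lambda>x. T (x / m k) / ((x / m k) * ln (x / m k)) *
        (((x / m k) * ln (x / m k)) / (x * ln x))) \<longlongrightarrow> c * (1 / m k)) at_top"
      by (rule tendsto_mult)
    \<comment> \<open>Cancelling requires \<open>ln (x / m k)\<close> to be nonzero, hence the
      restriction to x > m k.\<close>
    moreover have "\<forall>\<^sub>F x in at_top. T (x / m k) / ((x / m k) * ln (x / m k)) *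
        (((x / m k) * ln (x / m k)) / (x * ln x)) = T (x / m k) / (x * ln x)"
      using eventually_gt_at_top[of "m k"]
    proof eventually_elim
      case (elim x)
      define y where "y = x / m k"
      have "y * ln y \<noteq> 0" using elim mpos by (simp add: y_def)
      then show ?case unfolding y_def[symmetric] by simp
    qed
    ultimately show ?thesis by (simp add: filterlim_cong)
  qed
  have inv2: "1 / m k \<le> 1 / real (Suc k) ^ 2" for k
  proof -
    have "real (Suc k) ^ 2 \<le> m k"
      unfolding m_def of_nat_power using e by (intro power_increasing) auto
    then show ?thesis by (intro divide_left_mono) (auto simp: m_def)
  qed
  \<comment> \<open>From x \<ge> e on, ln x \<ge> 1 and so 1 + ln x \<le> 2 ln x, which is where the
    factor 2 comes from. If x / m k < 1, the count is 0.\<close>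
  have bound: "norm (T (x / m k) / (x * ln x)) \<le> 2 * C / real (Suc k) ^ 2"
    if x: "x \<ge> exp 1" for x k
  proof -
    have "exp 1 > (1::real)" by simp
    then have x1: "x > 1" using x by linarith
    have lx: "ln x \<ge> 1" using x x1 by (simp add: ln_ge_iff)
    have nn: "T (x / m k) \<ge> 0" by (simp add: T_def)
    have "T (x / m k) \<le> C * (x / m k) * (1 + ln x)"
    proof (cases "x / m k \<ge> 1")
      case True
      have "ln (x / m k) \<le> ln x" using True m1[of k] x1
        by (intro ln_mono) (auto simp: divide_le_eq mult_left_le)
      then have "C * (x / m k) * (1 + ln (x / m k)) \<le> C * (x / m k) * (1 + ln x)"
        using C(1) True by (intro mult_left_mono mult_nonneg_nonneg) auto
      with C(2)[OF True] show ?thesis by linarith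
    next
      case False
      then show ?thesis using T0[of "x / m k"] C(1) x1 lx m1[of k] by simp
    qed
    also have "\<dots> \<le> C * (x / m k) * (2 * ln x)"
      using C(1) x1 m1[of k] lx by (intro mult_left_mono mult_nonneg_nonneg) auto
    also have "\<dots> = 2 * C * (1 / m k) * (x * ln x)" by simp
    also have "\<dots> \<le> 2 * C * (1 / real (Suc k) ^ 2) * (x * ln x)"
      using C(1) x1 lx inv2[of k] by (intro mult_right_mono mult_left_mono) auto
    finally have "T (x / m k) / (x * ln x) \<le> 2 * C * (1 / real (Suc k) ^ 2)"
      using x1 lx by (simp add: pos_divide_le_eq)
    moreover have "T (x / m k) / (x * ln x) \<ge> 0" using nn x1 lx by simp
    ultimately show ?thesis by simp
  qed
  have sumM: "summable (\<lambda>k. 2 * C / real (Suc k) ^ 2)"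
  proof -
    have "summable (\<lambda>k. inverse (real (Suc k) ^ 2))"
      using inverse_power_summable[of 2, where 'a=real] by (subst summable_Suc_iff) auto
    from summable_mult[OF this, of "2 * C"] show ?thesis by (simp add: divide_inverse)
  qed
  have "\<forall>\<^sub>F (k, x) in at_top \<times>\<^sub>F at_top.
      norm (T (x / m k) / (x * ln x)) \<le> 2 * C / real (Suc k) ^ 2"
    unfolding eventually_prod_filter
    by (intro exI[of _ "\<lambda>_. True"] exI[of _ "\<lambda>x. x \<ge> exp 1"])
       (use bound in \<open>auto simp: eventually_ge_at_top\<close>)
  from tannerys_theorem[OF lim this sumM]
  have *: "summable (\<lambda>k. norm (c / m k))"
    "((\<lambda>x. \<Sum>k. T (x / m k) / (x * ln x)) \<longlongrightarrow> (\<Sum>k. c / m k)) at_top" by simp_all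
  have pos: "(\<Sum>k. c / m k) > 0"
  proof (rule suminf_pos)
    show "summable (\<lambda>k. c / m k)" using *(1) by (rule summable_norm_cancel)
    show "0 < c / m k" for k using c m1[of k] by (intro divide_pos_pos) auto
  qed
  have "(\<Sum>k. T (x / m k) / (x * ln x)) = real (card (L x)) / (x * ln x)" for x
  proof -
    obtain N where N: "real N \<ge> x" using real_arch_simple by blast
    have "summable (\<lambda>k. T (x / m k))"
    proof (rule summable_finite[of "{..<N}"])
      fix k assume "k \<notin> {..<N}"
      then have "x < m k" using N mk[of k] by simp
      then show "T (x / m k) = 0" using T0 m1[of k] by (simp add: field_simps)
    qed simp
    then show ?thesis by (simp add: cardL suminf_divide)
  qed
  with *(2) have "((\<lambda>x. real (card (L x)) / (x * ln x)) \<longlongrightarrow> (\<Sum>k. c / m k)) at_top" by simp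
  with fin wpos have "xlogx_count (S \<times> {n. n > 0}) (\<lambda>(a, n). w a * n ^ e) (\<Sum>k. c / m k)"
    unfolding xlogx_count_def L_def by (fastforce simp: Suc_le_eq)
  with pos show ?thesis by blast
qed

text \<open>Counting b for each fixed a gives the sum of the floors of x / a. Removing the floors
  costs at most x, which is of lower order than x ln x, so the crude estimate with the harmonic
  number already determines the main term.\<close>

lemma xlogx_count_pairs:
  "xlogx_count ({n. n > 0} \<times> {n. n > 0}) (\<lambda>(a, b). a * b) 1"
proof -
  define L where "L = (\<lambda>x::real. {q \<in> {n::nat. n > 0} \<times> {n. n > 0}. real ((\<lambda>(a, b). a * b) q) \<le> x})"
  have LU: "L x = (SIGMA a:{1..nat \<lfloor>x\<rfloor>}. {1..nat \<lfloor>x / real a\<rfloor>})" if "x \<ge> 1" for x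
  proof -
    have ab: "(a > 0 \<and> b > 0 \<and> real (a * b) \<le> x) \<longleftrightarrow>
       (1 \<le> a \<and> a \<le> nat \<lfloor>x\<rfloor> \<and> 1 \<le> b \<and> b \<le> nat \<lfloor>x / real a\<rfloor>)" for a b :: nat
    proof (cases "a > 0 \<and> b > 0")
      case True
      have 1: "b \<le> nat \<lfloor>x / real a\<rfloor> \<longleftrightarrow> real (a * b) \<le> x"
        using True that by (subst le_nat_iff) (auto simp: le_floor_iff pos_le_divide_eq mult.commute)
      have 2: "a \<le> nat \<lfloor>x\<rfloor> \<longleftrightarrow> real a \<le> x"
        using that by (subst le_nat_iff) (auto simp: le_floor_iff)
      have "a * 1 \<le> a * b" using True by (intro mult_left_mono) auto
      then have "real a \<le> real (a * b)" by (simp only: of_nat_le_iff mult_1_right)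
      then show ?thesis using 1 2 True by auto
    next
      case False then show ?thesis by auto
    qed
    have "{(a, b). a > 0 \<and> b > 0 \<and> real (a * b) \<le> x} =
        {(a, b). 1 \<le> a \<and> a \<le> nat \<lfloor>x\<rfloor> \<and> 1 \<le> b \<and> b \<le> nat \<lfloor>x / real a\<rfloor>}"
      by (simp only: ab)
    moreover have "L x = {(a, b). a > 0 \<and> b > 0 \<and> real (a * b) \<le> x}"
      by (auto simp: L_def)
    moreover have "{(a, b). 1 \<le> a \<and> a \<le> nat \<lfloor>x\<rfloor> \<and> 1 \<le> b \<and> b \<le> nat \<lfloor>x / real a\<rfloor>} =
        (SIGMA a:{1..nat \<lfloor>x\<rfloor>}. {1..nat \<lfloor>x / real a\<rfloor>})" by auto
    ultimately show ?thesis by simp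
  qed
  have fin: "finite (L x)" for x
  proof (cases "x \<ge> 1")
    case True then show ?thesis by (simp add: LU)
  next
    case False
    have "real (a * b) \<ge> 1" if "a > 0" "b > 0" for a b :: nat
      using that by (metis One_nat_def Suc_leI mult_pos_pos of_nat_1 of_nat_le_iff)
    then have "\<not> real (a * b) \<le> x" if "a > 0" "b > 0" for a b :: nat
      using False that by (meson order_trans)
    then have "L x = {}" unfolding L_def by (auto simp del: of_nat_mult)
    then show ?thesis by simp
  qed
  have bounds: "x * (ln x - 1) \<le> real (card (L x)) \<and> real (card (L x)) \<le> x * (ln x + 1)" if x: "x \<ge> 1" for x
  proof -
    define N where "N = nat \<lfloor>x\<rfloor>"
    have N: "N \<ge> 1" "real N \<le> x" "x < real N + 1"
      using x unfolding N_def by (auto simp: le_nat_iff le_floor_iff)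
    have cd: "real (card (L x)) = (\<Sum>a=1..N. real (nat \<lfloor>x / real a\<rfloor>))"
      by (simp add: LU[OF x] N_def)
    have h: "(\<Sum>a=1..N. x / real a) = x * harm N"
      by (simp add: harm_def sum_distrib_left divide_inverse)
    have "real (card (L x)) \<le> (\<Sum>a=1..N. x / real a)"
      unfolding cd using x by (intro sum_mono) (auto simp: of_nat_nat)
    moreover have "(\<Sum>a=1..N. x / real a - 1) \<le> real (card (L x))"
      unfolding cd using x by (intro sum_mono) linarith
    moreover have "(\<Sum>a=1..N. x / real a - 1) = x * harm N - real N"
      unfolding sum_subtractf h by simp
    \<comment> \<open>The sequence harm n - ln n decreases and equals 1 at n = 1.\<close>
    moreover have "harm N \<le> 1 + ln x"
    proof -
      have "harm N - ln (real N) \<le> harm 1 - ln (real 1)"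
        using N(1) by (intro euler_mascheroni_sequence_decreasing) auto
      moreover have "ln (real N) \<le> ln x" using N x by simp
      ultimately show ?thesis by (simp add: harm_expand)
    qed
    moreover have "harm N \<ge> ln x"
    proof -
      have "ln x \<le> ln (real N + 1)" using N x by simp
      with harm_ge_ln[of N] show ?thesis by linarith
    qed
    ultimately have "x * harm N - x \<le> real (card (L x))" "real (card (L x)) \<le> x * harm N"
      "x * ln x \<le> x * harm N" "x * harm N \<le> x * (1 + ln x)"
      using N x h by (auto intro: mult_left_mono)
    then show ?thesis by (simp add: algebra_simps)
  qed
  have "((\<lambda>x. real (card (L x)) / (x * ln x)) \<longlongrightarrow> 1) at_top"
  proof (rule tendsto_sandwich)
    show "((\<lambda>x::real. (ln x - 1) / ln x) \<longlongrightarrow> 1) at_top" by real_asymp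
    show "((\<lambda>x::real. (ln x + 1) / ln x) \<longlongrightarrow> 1) at_top" by real_asymp
    show "\<forall>\<^sub>F x in at_top. (ln x - 1) / ln x \<le> real (card (L x)) / (x * ln x)"
      using eventually_gt_at_top[of 1]
    proof eventually_elim
      case (elim x)
      then have "(ln x - 1) / ln x = (x * (ln x - 1)) / (x * ln x)" by simp
      also have "\<dots> \<le> real (card (L x)) / (x * ln x)"
        using bounds[of x] elim by (intro divide_right_mono) auto
      finally show ?case .
    qed
    show "\<forall>\<^sub>F x in at_top. real (card (L x)) / (x * ln x) \<le> (ln x + 1) / ln x"
      using eventually_gt_at_top[of 1]
    proof eventually_elim
      case (elim x)
      have "real (card (L x)) / (x * ln x) \<le> (x * (ln x + 1)) / (x * ln x)"
        using bounds[of x] elim by (intro divide_right_mono) auto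
      also have "\<dots> = (ln x + 1) / ln x" using elim by simp
      finally show ?case .
    qed
  qed
  with fin show ?thesis unfolding xlogx_count_def L_def by auto
qed

section \<open>Weighted tuples of positive integers\<close>

definition pos_lists :: "nat \<Rightarrow> nat list set" where
  "pos_lists r = {ns. length ns = r \<and> (\<forall>n\<in>set ns. n > 0)}"

text \<open>List positions start at 0, so \<open>ns ! k\<close> is the variable of weight k +
  1.\<close>

definition list_weight :: "nat list \<Rightarrow> nat" where
  "list_weight ns = (\<Prod>k<length ns. (ns ! k) ^ Suc k)"

lemma list_weight_snoc: "list_weight (ns @ [n]) = list_weight ns * n ^ Suc (length ns)"
proof -
  have "(\<Prod>k<length ns. ((ns @ [n]) ! k) ^ Suc k) = (\<Prod>k<length ns. (ns ! k) ^ Suc k)"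
    by (rule prod.cong) (auto simp: nth_append)
  then show ?thesis by (simp add: list_weight_def)
qed

text \<open>Lists of length 1 form the base case, since the two variables of weight 1 produce the
  logarithm. Each induction step appends one entry of weight r + 2 to both lists, that is, it
  multiplies the constant twice by zeta(r + 2).\<close>

lemma xlogx_count_pos_lists:
  "\<exists>c>0. xlogx_count (pos_lists (Suc r) \<times> pos_lists (Suc r))
           (\<lambda>(ns, ms). list_weight ns * list_weight ms) c"
proof (induction r)
  case 0
  have "bij_betw (\<lambda>(ns, ms). (hd ns, hd ms)) (pos_lists (Suc 0) \<times> pos_lists (Suc 0))
      ({n. n > 0} \<times> {n. n > 0})"
    by (rule bij_betw_byWitness[where f' = "\<lambda>(a, b). ([a], [b])"])
       (auto simp: pos_lists_def length_Suc_conv)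
  then have "xlogx_count (pos_lists (Suc 0) \<times> pos_lists (Suc 0))
           (\<lambda>(ns, ms). list_weight ns * list_weight ms) 1"
    by (rule xlogx_count_bij[OF xlogx_count_pairs])
       (auto simp: pos_lists_def length_Suc_conv list_weight_def)
  then show ?case by (intro exI[of _ 1]) auto
next
  case (Suc r)
  let ?P = "pos_lists (Suc r)" and ?Q = "pos_lists (Suc (Suc r))"
  obtain c where "c > 0" "xlogx_count (?P \<times> ?P) (\<lambda>(ns, ms). list_weight ns * list_weight ms) c"
    using Suc by blast
  then obtain c1 where c1: "c1 > 0" "xlogx_count ((?P \<times> ?P) \<times> {n. n > 0})
      (\<lambda>(a, n). (\<lambda>(ns, ms). list_weight ns * list_weight ms) a * n ^ Suc (Suc r)) c1"
    using xlogx_count_times_power[of _ _ c "Suc (Suc r)"] by auto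
  then obtain c2 where c2: "c2 > 0" "xlogx_count (((?P \<times> ?P) \<times> {n. n > 0}) \<times> {n. n > 0})
      (\<lambda>(b, m). (\<lambda>(a, n). (\<lambda>(ns, ms). list_weight ns * list_weight ms) a * n ^ Suc (Suc r)) b
          * m ^ Suc (Suc r)) c2"
    using xlogx_count_times_power[of _ _ c1 "Suc (Suc r)"] by auto
  have sp: "ns \<in> ?Q \<longleftrightarrow> (\<exists>as a. ns = as @ [a] \<and> as \<in> ?P \<and> a > 0)" for ns
  proof (cases ns rule: rev_cases)
    case Nil then show ?thesis by (auto simp: pos_lists_def)
  next
    case (snoc as a) then show ?thesis by (auto simp: pos_lists_def)
  qed
  have len: "length ns = Suc r" if "ns \<in> ?P" for ns using that by (simp add: pos_lists_def)
  have "bij_betw (\<lambda>(ns, ms). (((butlast ns, butlast ms), last ns), last ms)) (?Q \<times> ?Q)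
      (((?P \<times> ?P) \<times> {n. n > 0}) \<times> {n. n > 0})"
    by (rule bij_betw_byWitness[where f' = "\<lambda>(((as, bs), a), b). (as @ [a], bs @ [b])"])
       (auto simp: sp)
  then have "xlogx_count (?Q \<times> ?Q) (\<lambda>(ns, ms). list_weight ns * list_weight ms) c2"
    by (rule xlogx_count_bij[OF c2(2)])
       (auto simp: sp list_weight_snoc len)
  with c2(1) show ?case by blast
qed

section \<open>Structure of finite abelian groups\<close>

text \<open>A homomorphism to \<open>Z/N\<close> on \<open>H\<close> is represented by an integer-valued function taken modulo \<open>N\<close>.\<close>

definition hom_mod :: "('a, 'm) monoid_scheme \<Rightarrow> int \<Rightarrow> 'a set \<Rightarrow> ('a \<Rightarrow> int) \<Rightarrow> bool" where
  "hom_mod G N H f \<longleftrightarrow> (\<forall>x\<in>H. \<forall>y\<in>H. [f (x \<otimes>\<^bsub>G\<^esub> y) = f x + f y] (mod N))"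

lemma (in group) hom_mod_int_pow:
  assumes H: "subgroup H G" and f: "hom_mod G N H f" and x: "x \<in> H"
  shows "[f (x [^] (k::int)) = k * f x] (mod N)"
proof -
  have xc: "x \<in> carrier G" by (rule subgroup.mem_carrier[OF H x])
  have mul: "[f (y \<otimes> z) = f y + f z] (mod N)" if "y \<in> H" "z \<in> H" for y z
    using f that by (simp add: hom_mod_def)
  have inH: "x [^] (k::int) \<in> H" for k
    using subgroup_int_pow_closed[OF H x] .
  have "[f (\<one> \<otimes> \<one>) = f \<one> + f \<one>] (mod N)"
    by (rule mul) (auto intro: subgroup.one_closed[OF H])
  then have one: "[f \<one> = 0] (mod N)"
    by (simp add: cong_iff_dvd_diff)
  have nat: "[f (x [^] int n) = int n * f x] (mod N)" for n
  proof (induction n)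
    case 0 then show ?case using one by simp
  next
    case (Suc n)
    have "x [^] int (Suc n) = x [^] int n \<otimes> x"
      using int_pow_mult[OF xc, of "int n" 1] xc by (simp add: add.commute)
    then have "[f (x [^] int (Suc n)) = f (x [^] int n) + f x] (mod N)"
      using mul[OF inH x, of "int n"] by simp
    also have "[f (x [^] int n) + f x = int n * f x + f x] (mod N)"
      using Suc by (rule cong_add) simp
    finally show ?case by (simp add: algebra_simps)
  qed
  show ?thesis
  proof (cases k rule: int_cases2)
    case (nonneg n) then show ?thesis using nat by simp
  next
    case (nonpos n)
    have "x [^] (- int n) \<otimes> x [^] int n = \<one>"
      using xc by (simp add: int_pow_neg)
    then have "[f \<one> = f (x [^] (- int n)) + f (x [^] int n)] (mod N)"
      using mul[OF inH inH, of "- int n" "int n"] by simp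
    with one nat[of n] have "[f (x [^] (- int n)) + f (x [^] int n) - f (x [^] int n) = 0 - int n * f x] (mod N)"
      by (intro cong_diff) (auto intro: cong_trans cong_sym)
    then show ?thesis using nonpos by simp
  qed
qed

text \<open>The extension sends h g^k to f h + k d. The hypothesis on \<open>d\<close> is exactly
  the compatibility that makes this well defined modulo \<open>N\<close>.\<close>

lemma (in comm_group) hom_mod_adjoin:
  assumes H: "subgroup H G" and f: "hom_mod G N H f" and g: "g \<in> carrier G"
    and d: "\<And>k::int. g [^] k \<in> H \<Longrightarrow> [f (g [^] k) = k * d] (mod N)"
  obtains H' f' where "subgroup H' G" "H \<subseteq> H'" "g \<in> H'" "hom_mod G N H' f'"
    "[f' g = d] (mod N)" "\<And>h. h \<in> H \<Longrightarrow> [f' h = f h] (mod N)"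
proof -
  interpret H: subgroup H G by (rule H)
  have mul: "[f (y \<otimes> z) = f y + f z] (mod N)" if "y \<in> H" "z \<in> H" for y z
    using f that by (simp add: hom_mod_def)
  have "[f (\<one> \<otimes> \<one>) = f \<one> + f \<one>] (mod N)"
    by (rule mul) auto
  then have one: "[f \<one> = 0] (mod N)"
    by (simp add: cong_iff_dvd_diff)
  define H' where "H' = {h \<otimes> g [^] k | h k. h \<in> H \<and> (k::int) \<in> UNIV}"
  \<comment> \<open>\<open>s\<close> picks an arbitrary representation of an element as h g^k; by
    \<open>uniq\<close> the choice affects \<open>f'\<close> only by a multiple of
    \<open>N\<close>.\<close>
  define s where "s = (\<lambda>x. SOME q. fst q \<in> H \<and> x = fst q \<otimes> g [^] (snd q :: int))"
  define f' where "f' = (\<lambda>x. f (fst (s x)) + snd (s x) * d)"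
  \<comment> \<open>Two representations differ by the power g^(k1 - k2), which equals h1^(-1) h2 and
    thus lies in \<open>H\<close>, where the hypothesis on \<open>d\<close> applies.\<close>
  have uniq: "[f h1 + k1 * d = f h2 + k2 * d] (mod N)"
    if h: "h1 \<in> H" "h2 \<in> H" and eq: "h1 \<otimes> g [^] k1 = h2 \<otimes> g [^] k2" for h1 h2 and k1 k2 :: int
  proof -
    have c: "h1 \<in> carrier G" "h2 \<in> carrier G" using h by auto
    have "h1 \<otimes> g [^] (k1 - k2) = h2"
      using eq c g by (metis int_pow_closed int_pow_diff inv_closed m_assoc r_inv r_one)
    moreover from this have "g [^] (k1 - k2) = inv h1 \<otimes> h2"
      using c g by (metis int_pow_closed inv_solve_left)
    then have gH: "g [^] (k1 - k2) \<in> H" using h by simp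
    ultimately have "[f h2 = f h1 + f (g [^] (k1 - k2))] (mod N)"
      using mul[OF h(1) gH] by simp
    also have "[f h1 + f (g [^] (k1 - k2)) = f h1 + (k1 - k2) * d] (mod N)"
      using d[OF gH] by (intro cong_add) auto
    finally have "[f h2 + k2 * d = f h1 + (k1 - k2) * d + k2 * d] (mod N)"
      by (intro cong_add) auto
    then show ?thesis by (simp add: algebra_simps cong_sym)
  qed
  have f': "[f' (h \<otimes> g [^] k) = f h + k * d] (mod N)" if "h \<in> H" for h and k :: int
  proof -
    have "fst (h, k) \<in> H \<and> h \<otimes> g [^] k = fst (h, k) \<otimes> g [^] snd (h, k)" using that by simp
    then have "fst (s (h \<otimes> g [^] k)) \<in> H \<and>
        h \<otimes> g [^] k = fst (s (h \<otimes> g [^] k)) \<otimes> g [^] snd (s (h \<otimes> g [^] k))"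
      unfolding s_def by (rule someI)
    then show ?thesis unfolding f'_def using that by (intro uniq) auto
  qed
  have mulH': "(h1 \<otimes> g [^] k1) \<otimes> (h2 \<otimes> g [^] k2) = (h1 \<otimes> h2) \<otimes> g [^] (k1 + k2)"
    if "h1 \<in> H" "h2 \<in> H" for h1 h2 and k1 k2 :: int
    using that g by (simp add: int_pow_mult m_ac)
  show ?thesis
  proof (rule that[of H' f'])
    show "subgroup H' G"
    proof (rule subgroupI)
      show "H' \<subseteq> carrier G" using g by (auto simp: H'_def)
      have "\<one> \<otimes> g [^] (0::int) \<in> H'" unfolding H'_def using H.one_closed by blast
      then show "H' \<noteq> {}" by blast
    next
      fix x assume "x \<in> H'"
      then obtain h k where x: "x = h \<otimes> g [^] (k::int)" "h \<in> H" by (auto simp: H'_def)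
      then have "inv x = inv h \<otimes> g [^] (- k)" using g by (simp add: inv_mult int_pow_neg)
      then show "inv x \<in> H'" using x unfolding H'_def by auto
    next
      fix x y assume "x \<in> H'" "y \<in> H'"
      then obtain h k h' k' where "x = h \<otimes> g [^] (k::int)" "h \<in> H" "y = h' \<otimes> g [^] (k'::int)" "h' \<in> H"
        by (auto simp: H'_def)
      then have "x \<otimes> y = (h \<otimes> h') \<otimes> g [^] (k + k')" "h \<otimes> h' \<in> H" by (simp_all add: mulH')
      then show "x \<otimes> y \<in> H'" unfolding H'_def by blast
    qed
    have hH: "h = h \<otimes> g [^] (0::int)" if "h \<in> H" for h using that by simp
    then show "H \<subseteq> H'" unfolding H'_def by blast
    have g1: "g = \<one> \<otimes> g [^] (1::int)" using g by simp
    then show "g \<in> H'" using H.one_closed unfolding H'_def by blast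
    show "hom_mod G N H' f'"
      unfolding hom_mod_def
    proof (intro ballI)
      fix x y assume "x \<in> H'" "y \<in> H'"
      then obtain h k h' k' where xy: "x = h \<otimes> g [^] (k::int)" "h \<in> H" "y = h' \<otimes> g [^] (k'::int)" "h' \<in> H"
        by (auto simp: H'_def)
      then have "[f' (x \<otimes> y) = f (h \<otimes> h') + (k + k') * d] (mod N)"
        by (simp add: mulH' f')
      also have "[f (h \<otimes> h') + (k + k') * d = f h + f h' + (k + k') * d] (mod N)"
        using mul[of h h'] xy by (intro cong_add) auto
      also have "f h + f h' + (k + k') * d = (f h + k * d) + (f h' + k' * d)"
        by (simp add: algebra_simps)
      also have "[\<dots> = f' x + f' y] (mod N)"
        using f'[of h k] f'[of h' k'] xy by (intro cong_add) (auto intro: cong_sym)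
      finally show "[f' (x \<otimes> y) = f' x + f' y] (mod N)" .
    qed
    show "[f' g = d] (mod N)"
    proof -
      have "[f' g = f \<one> + 1 * d] (mod N)" using f'[of \<one> 1] g by simp
      also have "[f \<one> + 1 * d = 0 + 1 * d] (mod N)" using one by (intro cong_add) auto
      finally show ?thesis by simp
    qed
    show "[f' h = f h] (mod N)" if "h \<in> H" for h
      using f'[of h 0] that by simp
  qed
qed

text \<open>
  A maximal partial homomorphism \<open>f\<close> is total: if \<open>q\<close> is the least positive integer with \<open>g^q\<close> in
  its domain and \<open>c = f (g^q)\<close>, extending it to \<open>g\<close> amounts to solving \<open>q d = c\<close> modulo \<open>N\<close>.
  As \<open>g^(m N) = 1\<close>, we have \<open>m N = q w\<close> and \<open>w c = N z\<close>, hence \<open>q z = m c\<close>; since \<open>m\<close> is coprime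
  to \<open>N\<close>, this makes \<open>gcd(q, N)\<close> a divisor of \<open>c\<close>.
\<close>

lemma (in comm_group) exists_hom_mod:
  assumes fin: "finite (carrier G)" and a: "a \<in> carrier G" and ord: "ord a = N"
    and exp: "\<And>g. g \<in> carrier G \<Longrightarrow> g [^] (m * N) = \<one>" and cop: "coprime m N"
  obtains f where "hom_mod G (int N) (carrier G) f" "[f a = 1] (mod int N)"
proof -
  have N: "N > 0" using ord_ge_1[OF fin a] ord by simp
  \<comment> \<open>\<open>Q\<close> speaks of domains and hides the map: as the group is finite, a
    domain of largest cardinality exists, and this is the maximality that is used.\<close>
  define Q where "Q = (\<lambda>H. subgroup H G \<and> a \<in> H \<and>
      (\<exists>f. hom_mod G (int N) H f \<and> [f a = 1] (mod int N)))"
  \<comment> \<open>The start adjoins \<open>a\<close> with value 1 to the trivial subgroup; this is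
    consistent because a^k = 1 forces \<open>N\<close> to divide k.\<close>
  have "\<exists>H. Q H"
  proof -
    have hm: "hom_mod G (int N) {\<one>} (\<lambda>_. 0)" by (simp add: hom_mod_def)
    have "[0 = k * 1] (mod int N)" if "a [^] k \<in> {\<one>}" for k :: int
      using that a ord by (simp add: int_pow_eq_id cong_iff_dvd_diff)
    from hom_mod_adjoin[OF triv_subgroup hm a this]
    show ?thesis unfolding Q_def by (metis (no_types))
  qed
  moreover have Qfin: "Q H \<Longrightarrow> H \<subseteq> carrier G" for H
    unfolding Q_def using subgroup.subset by blast
  then have "\<forall>H. Q H \<longrightarrow> card H < Suc (card (carrier G))"
    using fin by (simp add: card_mono less_Suc_eq_le)
  ultimately obtain H where QH: "Q H" and max: "\<And>H'. Q H' \<Longrightarrow> card H' \<le> card H"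
    using ex_has_greatest_nat[of Q _ card "Suc (card (carrier G))"] by metis
  obtain f where H: "subgroup H G" "a \<in> H" and f: "hom_mod G (int N) H f" "[f a = 1] (mod int N)"
    using QH by (auto simp: Q_def)
  interpret H: subgroup H G by (rule H)
  have "carrier G \<subseteq> H"
  proof
    fix g assume g: "g \<in> carrier G"
    define q where "q = (LEAST n. n > 0 \<and> g [^] (n::nat) \<in> H)"
    have "ord g > 0 \<and> g [^] ord g \<in> H" using g ord_ge_1[OF fin g] by simp
    then have q: "q > 0" "g [^] q \<in> H" unfolding q_def by (rule LeastI2; simp)+
    \<comment> \<open>Division with remainder: a nonzero remainder would be a smaller positive
      exponent that takes \<open>g\<close> into \<open>H\<close>.\<close>
    have qdvd: "int q dvd k" if k: "g [^] k \<in> H" for k :: int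
    proof (rule ccontr)
      assume "\<not> int q dvd k"
      then have "k mod int q \<noteq> 0" by (simp add: dvd_eq_mod_eq_0)
      moreover have "k mod int q \<ge> 0" using q by simp
      ultimately have r0: "k mod int q > 0" by linarith
      have "k mod int q = k - int q * (k div int q)" by (simp add: minus_mult_div_eq_mod)
      then have "g [^] (k mod int q) = g [^] k \<otimes> inv ((g [^] int q) [^] (k div int q))"
        using g by (simp add: int_pow_diff int_pow_pow)
      moreover have "(g [^] int q) [^] (k div int q) \<in> H"
        using subgroup_int_pow_closed[OF H(1)] q by (simp add: int_pow_int)
      ultimately have "g [^] (k mod int q) \<in> H" using k by simp
      then have "g [^] nat (k mod int q) \<in> H"
        using r0 by (metis int_nat_eq int_pow_int less_le)
      with r0 have "q \<le> nat (k mod int q)" unfolding q_def by (intro Least_le) auto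
      then show False using pos_mod_bound[of "int q" k] q by linarith
    qed
    define c where "c = f (g [^] q)"
    have "gcd (int q) (int N) dvd c"
    proof -
      have "g [^] (int (m * N)) \<in> H" using exp[OF g] by (simp only: int_pow_int) simp
      from qdvd[OF this] obtain w where w: "int (m * N) = int q * w" by (auto elim: dvdE)
      have "(g [^] int q) [^] w = \<one>" using g w exp[OF g] by (metis int_pow_int int_pow_pow)
      then have "(g [^] q) [^] w = \<one>" by (simp add: int_pow_int)
      then have "[f \<one> = w * c] (mod int N)"
        using hom_mod_int_pow[OF H(1) f(1) q(2), of w] by (simp add: c_def)
      moreover have "[f \<one> = 0] (mod int N)"
        using hom_mod_int_pow[OF H(1) f(1) q(2), of 0] by simp
      ultimately have "int N dvd w * c"
        by (metis cong_0_iff cong_sym cong_trans)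
      then obtain z where z: "w * c = int N * z" by (auto elim: dvdE)
      have "int N * (int q * z) = int N * (int m * c)"
        using w z by (metis (no_types, opaque_lifting) mult.assoc mult.left_commute of_nat_mult)
      then have "int q * z = int m * c" using N by simp
      then have "gcd (int q) (int N) dvd int m * c"
        by (metis dvd_mult2 gcd_dvd1)
      moreover have "coprime (gcd (int q) (int N)) (int m)"
        using cop by (metis coprime_commute coprime_divisors coprime_int_iff dvd_refl gcd_dvd2)
      ultimately show ?thesis by (simp add: coprime_dvd_mult_right_iff)
    qed
    then obtain d where d: "[int q * d = c] (mod int N)" using cong_solve_dvd_int by blast
    have "[f (g [^] k) = k * d] (mod int N)" if gk: "g [^] k \<in> H" for k :: int
    proof -
      obtain t where t: "k = int q * t" using qdvd[OF gk] by (auto elim: dvdE)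
      have "g [^] k = (g [^] q) [^] t" using g t by (metis int_pow_int int_pow_pow)
      then have "[f (g [^] k) = t * c] (mod int N)"
        using hom_mod_int_pow[OF H(1) f(1) q(2), of t] by (simp add: c_def)
      also have "[t * c = t * (int q * d)] (mod int N)"
        using d by (intro cong_mult) (auto intro: cong_sym)
      finally show ?thesis by (simp add: t mult_ac)
    qed
    from hom_mod_adjoin[OF H(1) f(1) g this]
    obtain H' f' where H': "subgroup H' G" "H \<subseteq> H'" "g \<in> H'" "hom_mod G (int N) H' f'"
      "\<And>h. h \<in> H \<Longrightarrow> [f' h = f h] (mod int N)" by metis
    have "[f' a = 1] (mod int N)" using H'(5)[OF H(2)] f(2) by (rule cong_trans)
    then have "Q H'" using H' H(2) unfolding Q_def by blast
    then have "H' = H" using max[of H'] H'(2) finite_subset[OF Qfin fin]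
      by (metis card_seteq)
    then show "g \<in> H" using H'(3) by simp
  qed
  then have "H = carrier G" using H.subset by blast
  then show ?thesis using that f by blast
qed

section \<open>Products of cyclic groups\<close>

lemma product_group_cong:
  assumes "I = J" "\<And>i. i \<in> J \<Longrightarrow> G i = H i"
  shows "product_group I G = product_group J H"
  unfolding product_group_def using assms
  by (auto intro!: PiE_cong restrict_ext ext)

lemma product_group_reindex:
  assumes f: "bij_betw f J I"
  shows "product_group I G \<cong> product_group J (\<lambda>j. G (f j))"
proof -
  let ?h = "\<lambda>x. \<lambda>j\<in>J. x (f j)"
  have fI: "f j \<in> I" if "j \<in> J" for j using f that by (auto simp: bij_betw_def)
  define f' where "f' = inv_into J f"
  have f'J: "f' i \<in> J" "f (f' i) = i" if "i \<in> I" for i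
    using f that unfolding f'_def bij_betw_def by (auto intro: inv_into_into f_inv_into_f)
  have f'f: "f' (f j) = j" if "j \<in> J" for j
    using f that unfolding f'_def bij_betw_def by (auto intro: inv_into_f_f)
  have hom: "?h \<in> hom (product_group I G) (product_group J (\<lambda>j. G (f j)))"
    by (rule homI) (auto simp: fI PiE_iff intro!: restrict_ext)
  have "bij_betw ?h (\<Pi>\<^sub>E i\<in>I. carrier (G i)) (\<Pi>\<^sub>E j\<in>J. carrier (G (f j)))"
  proof (rule bij_betw_byWitness[where f' = "\<lambda>y. \<lambda>i\<in>I. y (f' i)"])
    show "\<forall>x\<in>\<Pi>\<^sub>E i\<in>I. carrier (G i). (\<lambda>i\<in>I. ?h x (f' i)) = x"
      by (auto simp: f'J intro!: PiE_ext[of _ I "\<lambda>i. carrier (G i)"])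
    show "\<forall>y\<in>\<Pi>\<^sub>E j\<in>J. carrier (G (f j)). ?h (\<lambda>i\<in>I. y (f' i)) = y"
      by (auto simp: f'f fI intro!: PiE_ext[of _ J "\<lambda>j. carrier (G (f j))"])
    show "?h ` (\<Pi>\<^sub>E i\<in>I. carrier (G i)) \<subseteq> (\<Pi>\<^sub>E j\<in>J. carrier (G (f j)))"
      using fI by auto
    show "(\<lambda>y. \<lambda>i\<in>I. y (f' i)) ` (\<Pi>\<^sub>E j\<in>J. carrier (G (f j))) \<subseteq> (\<Pi>\<^sub>E i\<in>I. carrier (G i))"
      using f'J by (fastforce simp: PiE_iff)
  qed
  with hom show ?thesis unfolding is_iso_def iso_def by auto
qed

text \<open>One list holds the moduli of all primes together, so that isomorphism types become
  multisets of prime powers. An entry 0 stands for the infinite group Z, whence the assumption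
  \<open>0 \<notin> set qs\<close> in what follows.\<close>

definition cyclic_product :: "nat list \<Rightarrow> (nat \<Rightarrow> int) monoid" where
  "cyclic_product qs = product_group {..<length qs} (\<lambda>i. integer_mod_group (qs ! i))"

lemma group_cyclic_product [simp]: "group (cyclic_product qs)"
  by (simp add: cyclic_product_def)

lemma comm_group_cyclic_product: "comm_group (cyclic_product qs)"
  by (rule group.group_comm_groupI[OF group_cyclic_product])
     (auto simp: cyclic_product_def add.commute intro!: restrict_ext)

lemma abelian_p_group_eq: "abelian_p_group p as = cyclic_product (map (\<lambda>a. p ^ a) as)"
  unfolding abelian_p_group_def cyclic_product_def by (rule product_group_cong) auto

lemma carrier_cyclic_product:
  assumes "0 \<notin> set qs"
  shows "carrier (cyclic_product qs) = (\<Pi>\<^sub>E i\<in>{..<length qs}. {0..<int (qs ! i)})"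
proof -
  have "qs ! i \<noteq> 0" if "i < length qs" for i using assms that by (metis nth_mem)
  then show ?thesis unfolding cyclic_product_def carrier_product_group carrier_integer_mod_group
    by (intro PiE_cong) auto
qed

lemma finite_cyclic_product:
  assumes "0 \<notin> set qs"
  shows "finite (carrier (cyclic_product qs))"
  unfolding carrier_cyclic_product[OF assms] by (rule finite_PiE) auto

lemma card_cyclic_product:
  assumes "0 \<notin> set qs"
  shows "card (carrier (cyclic_product qs)) = prod_list qs"
  unfolding carrier_cyclic_product[OF assms]
  by (simp add: card_PiE prod.list_conv_set_nth atLeast0LessThan)

lemma cyclic_product_snoc:
  "cyclic_product qs \<times>\<times> integer_mod_group q \<cong> cyclic_product (qs @ [q])"
proof -
  define n where "n = length qs"
  define I where "I = {..<n}"
  define G where "G = (\<lambda>i. integer_mod_group ((qs @ [q]) ! i))"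
  have nI: "n \<notin> I" by (simp add: I_def)
  have P: "cyclic_product qs = product_group I G"
    unfolding cyclic_product_def I_def G_def n_def
    by (rule product_group_cong) (simp_all add: nth_append)
  have P': "cyclic_product (qs @ [q]) = product_group (insert n I) G"
    unfolding cyclic_product_def I_def G_def n_def by (simp add: lessThan_Suc)
  have Z: "integer_mod_group q = G n" by (simp add: G_def n_def)
  let ?h = "\<lambda>(x, c). x(n := c)"
  have "bij_betw ?h ((\<Pi>\<^sub>E i\<in>I. carrier (G i)) \<times> carrier (G n)) (\<Pi>\<^sub>E i\<in>insert n I. carrier (G i))"
  \<comment> \<open>Elements of the product over \<open>I\<close> take the value
    \<open>undefined\<close> outside \<open>I\<close>, so the inverse has to reset coordinate
    \<open>n\<close> to \<open>undefined\<close>.\<close>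
  proof (rule bij_betw_byWitness[where f' = "\<lambda>y. (y(n := undefined), y n)"])
    show "\<forall>z\<in>(\<Pi>\<^sub>E i\<in>I. carrier (G i)) \<times> carrier (G n). ((?h z)(n := undefined), ?h z n) = z"
    proof
      fix z assume "z \<in> (\<Pi>\<^sub>E i\<in>I. carrier (G i)) \<times> carrier (G n)"
      then obtain x c where z: "z = (x, c)" and x: "x \<in> (\<Pi>\<^sub>E i\<in>I. carrier (G i))" by blast
      have "x n = undefined" using x nI by (rule PiE_arb)
      then show "((?h z)(n := undefined), ?h z n) = z"
        by (simp add: z fun_upd_idem)
    qed
    show "\<forall>y\<in>(\<Pi>\<^sub>E i\<in>insert n I. carrier (G i)). ?h (y(n := undefined), y n) = y" by simp
    show "?h ` ((\<Pi>\<^sub>E i\<in>I. carrier (G i)) \<times> carrier (G n)) \<subseteq> (\<Pi>\<^sub>E i\<in>insert n I. carrier (G i))"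
    proof (rule image_subsetI)
      fix z assume "z \<in> (\<Pi>\<^sub>E i\<in>I. carrier (G i)) \<times> carrier (G n)"
      then obtain x c where "z = (x, c)" "x \<in> (\<Pi>\<^sub>E i\<in>I. carrier (G i))" "c \<in> carrier (G n)"
        by blast
      then show "?h z \<in> (\<Pi>\<^sub>E i\<in>insert n I. carrier (G i))" by (simp add: PiE_fun_upd)
    qed
    show "(\<lambda>y. (y(n := undefined), y n)) ` (\<Pi>\<^sub>E i\<in>insert n I. carrier (G i))
        \<subseteq> (\<Pi>\<^sub>E i\<in>I. carrier (G i)) \<times> carrier (G n)"
      using nI by (auto intro: fun_upd_in_PiE PiE_mem)
  qed
  moreover have "?h \<in> hom (product_group I G \<times>\<times> G n) (product_group (insert n I) G)"
  proof (rule homI)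
    fix z assume "z \<in> carrier (product_group I G \<times>\<times> G n)"
    then obtain x c where "z = (x, c)" "x \<in> (\<Pi>\<^sub>E i\<in>I. carrier (G i))" "c \<in> carrier (G n)"
      by auto
    then show "?h z \<in> carrier (product_group (insert n I) G)"
      by (simp add: PiE_fun_upd)
  next
    fix z w
    show "?h (z \<otimes>\<^bsub>product_group I G \<times>\<times> G n\<^esub> w) = ?h z \<otimes>\<^bsub>product_group (insert n I) G\<^esub> ?h w"
      using nI by (cases z; cases w) (simp add: fun_eq_iff restrict_def)
  qed
  ultimately show ?thesis
    unfolding is_iso_def iso_def P P' Z by auto
qed

lemma cyclic_product_perm:
  assumes "mset qs = mset qs'"
  shows "cyclic_product qs \<cong> cyclic_product qs'"
proof -
  obtain f where f: "bij_betw f {..<length qs'} {..<length qs}" "\<And>i. i < length qs' \<Longrightarrow> qs' ! i = qs ! f i"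
    using permutation_Ex_bij[of qs' qs] assms by metis
  have "cyclic_product qs' = product_group {..<length qs'} (\<lambda>j. integer_mod_group (qs ! f j))"
    unfolding cyclic_product_def using f(2) by (intro product_group_cong) auto
  then show ?thesis using product_group_reindex[OF f(1), of "\<lambda>i. integer_mod_group (qs ! i)"]
    by (simp add: cyclic_product_def)
qed

section \<open>Splitting off cyclic factors and the structure theorem\<close>

lemma DirProd_iso_cong:
  assumes "G \<cong> G'" "H \<cong> H'"
  shows "G \<times>\<times> H \<cong> G' \<times>\<times> H'"
proof -
  obtain f g where "f \<in> iso G G'" "g \<in> iso H H'" using assms by (auto simp: is_iso_def)
  then have "(\<lambda>(x, y). (f x, g y)) \<in> iso (G \<times>\<times> H) (G' \<times>\<times> H')"
    unfolding iso_def bij_betw_def inj_on_def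
    by (auto simp: hom_def Pi_iff mult_DirProd' image_iff) (metis imageE)+
  then show ?thesis by (auto simp: is_iso_def)
qed

text \<open>The kernel \<open>K\<close> of \<open>f\<close> is a complement of the cyclic subgroup
  generated by \<open>a\<close>. On a product of an element of \<open>K\<close> with a^c the map
  \<open>f\<close> returns c, which gives injectivity; and any z is the product of z a^(-c), which
  lies in \<open>K\<close>, and a^c, where c is the residue of \<open>f z\<close>.\<close>

lemma (in comm_group) split_cyclic_factor:
  assumes fin: "finite (carrier G)" and a: "a \<in> carrier G" and ord: "ord a = N"
    and f: "hom_mod G (int N) (carrier G) f" "[f a = 1] (mod int N)"
  obtains K where "subgroup K G" "(G\<lparr>carrier := K\<rparr>) \<times>\<times> integer_mod_group N \<cong> G"
proof -
  have N: "N > 0" using ord_ge_1[OF fin a] ord by simp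
  have mul: "[f (y \<otimes> z) = f y + f z] (mod int N)" if "y \<in> carrier G" "z \<in> carrier G" for y z
    using f(1) that by (simp add: hom_mod_def)
  have pw: "[f (x [^] (k::int)) = k * f x] (mod int N)" if "x \<in> carrier G" for x k
    by (rule hom_mod_int_pow[OF subgroup_self f(1) that])
  have apw: "[f (a [^] (k::int)) = k] (mod int N)" for k
  proof -
    have "[k * f a = k * 1] (mod int N)" using f(2) by (intro cong_mult) auto
    with pw[OF a, of k] show ?thesis by (metis cong_trans mult.right_neutral)
  qed
  have aN: "a [^] (k::int) = a [^] (l::int)" if "[k = l] (mod int N)" for k l
    using that a ord by (simp add: int_pow_eq cong_iff_dvd_diff dvd_diff_commute)
  define K where "K = {x \<in> carrier G. [f x = 0] (mod int N)}"
  have K: "subgroup K G"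
  proof (rule subgroupI)
    show "K \<subseteq> carrier G" by (auto simp: K_def)
    have "\<one> \<in> K" using pw[OF one_closed, of 0] by (simp add: K_def)
    then show "K \<noteq> {}" by blast
  next
    fix x assume "x \<in> K"
    then have x: "x \<in> carrier G" "[f x = 0] (mod int N)" by (auto simp: K_def)
    have "[f (inv x) = (-1) * f x] (mod int N)" using pw[OF x(1), of "-1"] x(1)
      by (simp add: int_pow_neg)
    also have "[(-1) * f x = (-1) * 0] (mod int N)" using x(2) by (intro cong_mult) auto
    finally show "inv x \<in> K" using x(1) by (simp add: K_def)
  next
    fix x y assume "x \<in> K" "y \<in> K"
    then have xy: "x \<in> carrier G" "[f x = 0] (mod int N)" "y \<in> carrier G" "[f y = 0] (mod int N)"
      by (auto simp: K_def)
    have "[f (x \<otimes> y) = f x + f y] (mod int N)" using xy by (intro mul)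
    also have "[f x + f y = 0 + 0] (mod int N)" using xy by (intro cong_add)
    finally show "x \<otimes> y \<in> K" using xy by (simp add: K_def)
  qed
  let ?Z = "integer_mod_group N"
  let ?h = "\<lambda>(x, c::int). x \<otimes> a [^] c"
  have cZ: "carrier ?Z = {0..<int N}" using N by (simp add: carrier_integer_mod_group)
  have fh: "[f (x \<otimes> a [^] c) = c] (mod int N)" if "x \<in> K" for x and c :: int
  proof -
    have x: "x \<in> carrier G" "[f x = 0] (mod int N)" using that by (auto simp: K_def)
    have "[f (x \<otimes> a [^] c) = f x + f (a [^] c)] (mod int N)" using x a by (intro mul) auto
    also have "[f x + f (a [^] c) = 0 + c] (mod int N)" using x apw by (intro cong_add)
    finally show ?thesis by simp
  qed
  have hom: "?h \<in> hom ((G\<lparr>carrier := K\<rparr>) \<times>\<times> ?Z) G"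
  proof (rule homI)
    fix z assume "z \<in> carrier ((G\<lparr>carrier := K\<rparr>) \<times>\<times> ?Z)"
    then show "?h z \<in> carrier G" using a by (auto simp: K_def)
  next
    fix z w assume zw: "z \<in> carrier ((G\<lparr>carrier := K\<rparr>) \<times>\<times> ?Z)" "w \<in> carrier ((G\<lparr>carrier := K\<rparr>) \<times>\<times> ?Z)"
    obtain x c y d where e: "z = (x, c)" "w = (y, d)" by (cases z; cases w)
    have xy: "x \<in> carrier G" "y \<in> carrier G" using zw e by (auto simp: K_def)
    have "a [^] ((c + d) mod int N) = a [^] (c + d)" by (rule aN) (simp add: cong_def)
    then show "?h (z \<otimes>\<^bsub>(G\<lparr>carrier := K\<rparr>) \<times>\<times> ?Z\<^esub> w) = ?h z \<otimes> ?h w"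
      using xy a by (simp add: e int_pow_mult m_ac)
  qed
  have inj: "inj_on ?h (K \<times> {0..<int N})"
  proof (rule inj_onI)
    fix z w assume zw: "z \<in> K \<times> {0..<int N}" "w \<in> K \<times> {0..<int N}" "?h z = ?h w"
    obtain x c y d where e: "z = (x, c)" "w = (y, d)" by (cases z; cases w)
    have "[c = d] (mod int N)"
      using fh[of x c] fh[of y d] zw e by (auto intro: cong_trans cong_sym)
    then have "c = d" using zw e by (auto simp: cong_def)
    moreover have "x \<in> carrier G" "y \<in> carrier G" using zw e by (auto simp: K_def)
    ultimately have "x = y" using zw(3) e a by simp
    then show "z = w" using e \<open>c = d\<close> by simp
  qed
  have "?h ` (K \<times> {0..<int N}) = carrier G"
  proof (intro equalityI subsetI)
    fix z assume "z \<in> ?h ` (K \<times> {0..<int N})"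
    then show "z \<in> carrier G" using a by (auto simp: K_def)
  next
    fix z assume z: "z \<in> carrier G"
    define c where "c = f z mod int N"
    define x where "x = z \<otimes> a [^] (- c)"
    have "[f x = f z + f (a [^] (- c))] (mod int N)" unfolding x_def using z a by (intro mul) auto
    also have "[f z + f (a [^] (- c)) = c + (- c)] (mod int N)"
      using apw by (intro cong_add) (auto simp: c_def cong_def)
    finally have "x \<in> K" using z a by (simp add: K_def x_def)
    moreover have "z = x \<otimes> a [^] c" using z a by (simp add: x_def m_assoc flip: int_pow_mult)
    moreover have "c \<in> {0..<int N}" using N by (simp add: c_def)
    ultimately show "z \<in> ?h ` (K \<times> {0..<int N})" by force
  qed
  with inj hom have "?h \<in> iso ((G\<lparr>carrier := K\<rparr>) \<times>\<times> ?Z) G"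
    by (simp add: iso_def bij_betw_def cZ)
  with K that show ?thesis unfolding is_iso_def by blast
qed

text \<open>Induction on the order: for a prime p dividing the order of some element, an element of
  maximal p-power order is found and split off. The complement is smaller and supplies the remaining
  moduli.\<close>

theorem finite_comm_group_iso_cyclic_product:
  fixes G :: "('a, 'm) monoid_scheme"
  assumes "comm_group G" "finite (carrier G)"
  shows "\<exists>qs. (\<forall>q\<in>set qs. primepow q) \<and> G \<cong> cyclic_product qs"
  using assms
proof (induction "card (carrier G)" arbitrary: G rule: less_induct)
  case less
  interpret comm_group G by (rule less.prems)
  note fin = less.prems(2)
  show ?case
  proof (cases "carrier G = {\<one>\<^bsub>G\<^esub>}")
    case True
    have "(\<lambda>_. (\<lambda>_. undefined)) \<in> iso G (cyclic_product [])"
      using True by (auto simp: iso_def hom_def cyclic_product_def bij_betw_def)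
    then show ?thesis by (intro exI[of _ "[]"]) (auto simp: is_iso_def)
  next
    case False
    then obtain b where b: "b \<in> carrier G" "b \<noteq> \<one>\<^bsub>G\<^esub>" using one_closed by blast
    have "ord b \<noteq> 1" using b by (simp add: ord_eq_1[simplified])
    then obtain p where p: "prime p" "p dvd ord b" using prime_factor_nat by blast
    have ordG: "Coset.order G > 0" using fin by (simp add: order_gt_0_iff_finite)
    define s where "s = multiplicity p (Coset.order G)"
    obtain m where m: "Coset.order G = p ^ s * m" "\<not> p dvd m"
      using multiplicity_decompose'[of "Coset.order G" p] p(1) ordG unfolding s_def
      by (metis not_prime_unit less_irrefl)
    \<comment> \<open>\<open>m\<close> absorbs all primes other than \<open>p\<close>, so the least
      \<open>e\<close> with \<open>E e\<close> belongs to the exponent of the p-part. The form m p^e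
      is the one that the extension of homomorphisms asks for.\<close>
    define E where "E = (\<lambda>e. \<forall>g\<in>carrier G. g [^]\<^bsub>G\<^esub> (m * p ^ e) = \<one>\<^bsub>G\<^esub>)"
    have "E s" unfolding E_def using m(1) pow_order_eq_1 by (simp add: mult.commute)
    define e where "e = (LEAST e. E e)"
    have Ee: "E e" unfolding e_def using \<open>E s\<close> by (rule LeastI)
    \<comment> \<open>The order of \<open>b\<close> is divisible by \<open>p\<close> while
      \<open>m\<close> is not; hence the cyclic factor is nontrivial and the induction
      descends.\<close>
    have e0: "e \<noteq> 0"
    proof
      assume "e = 0"
      then have "b [^]\<^bsub>G\<^esub> m = \<one>\<^bsub>G\<^esub>" using Ee b by (simp add: E_def)
      then have "p dvd m" using b(1) p(2) by (metis dvd_trans pow_eq_id)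
      then show False using m by simp
    qed
    then have "\<not> E (e - 1)" unfolding e_def by (intro not_less_Least) (simp add: e_def[symmetric])
    then obtain g where g: "g \<in> carrier G" "g [^]\<^bsub>G\<^esub> (m * p ^ (e - 1)) \<noteq> \<one>\<^bsub>G\<^esub>" by (auto simp: E_def)
    \<comment> \<open>Raising to the power \<open>m\<close> removes the part prime to
      \<open>p\<close>; as m p^(e - 1) does not annihilate \<open>g\<close>, the order of
      \<open>a\<close> is exactly p^e.\<close>
    define a where "a = g [^]\<^bsub>G\<^esub> m"
    have a: "a \<in> carrier G" using g by (simp add: a_def)
    have "a [^]\<^bsub>G\<^esub> (p ^ e) = \<one>\<^bsub>G\<^esub>" using Ee g by (simp add: a_def E_def nat_pow_pow)
    then have "ord a dvd p ^ e" using a by (simp add: pow_eq_id)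
    moreover have "\<not> ord a dvd p ^ (e - 1)" using g a by (simp add: a_def nat_pow_pow flip: pow_eq_id)
    ultimately have ord: "ord a = p ^ e"
    proof -
      obtain i where i: "i \<le> e" "ord a = p ^ i"
        using divides_primepow_nat[OF p(1)] \<open>ord a dvd p ^ e\<close> by blast
      with \<open>\<not> ord a dvd p ^ (e - 1)\<close> have "\<not> i \<le> e - 1" using le_imp_power_dvd by metis
      with i e0 have "i = e" by simp
      with i show ?thesis by simp
    qed
    have "coprime m (p ^ e)"
      using m(2) p(1) by (metis coprime_commute coprime_power_right_iff prime_imp_coprime)
    then obtain f where f: "hom_mod G (int (p ^ e)) (carrier G) f" "[f a = 1] (mod int (p ^ e))"
      using exists_hom_mod[OF fin a ord] Ee unfolding E_def by metis
    obtain K where K: "subgroup K G" "(G\<lparr>carrier := K\<rparr>) \<times>\<times> integer_mod_group (p ^ e) \<cong> G"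
      using split_cyclic_factor[OF fin a ord f] by blast
    let ?K = "G\<lparr>carrier := K\<rparr>" and ?Z = "integer_mod_group (p ^ e)"
    have pe: "p ^ e > 1" using p(1) e0 prime_gt_1_nat by (intro one_less_power) auto
    have finK: "finite K" using K(1) fin subgroup.subset finite_subset by metis
    have "card (carrier (?K \<times>\<times> ?Z)) = card (carrier G)"
      using K(2) by (auto simp: is_iso_def iso_def intro: bij_betw_same_card)
    then have "card K * p ^ e = card (carrier G)"
      using pe prime_gt_0_nat[OF p(1)]
      by (simp add: card_cartesian_product carrier_integer_mod_group nat_power_eq)
    moreover have "card K > 0" using finK subgroup.one_closed[OF K(1)] card_gt_0_iff by blast
    ultimately have "card K < card (carrier G)" using pe
      by (metis mult.right_neutral nat_mult_less_cancel1)
    moreover have "comm_group ?K"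
      using subgroup.subset[OF K(1)] m_comm
      by (intro group.group_comm_groupI subgroup.subgroup_is_group[OF K(1) is_group]) auto
    ultimately obtain qs where qs: "\<forall>q\<in>set qs. primepow q" "?K \<cong> cyclic_product qs"
      using less.hyps[of ?K] finK by auto
    have "G \<cong> ?K \<times>\<times> ?Z"
      using group.iso_sym[OF _ K(2)] DirProd_group subgroup.subgroup_is_group[OF K(1)] is_group
        group_integer_mod_group by blast
    also have "\<dots> \<cong> cyclic_product qs \<times>\<times> ?Z"
      using qs(2) iso_refl by (rule DirProd_iso_cong)
    also have "\<dots> \<cong> cyclic_product (qs @ [p ^ e])" by (rule cyclic_product_snoc)
    finally have "G \<cong> cyclic_product (qs @ [p ^ e])" .
    moreover have "primepow (p ^ e)" using p(1) e0 by (simp add: primepow_prime_power)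
    ultimately show ?thesis using qs(1) by (intro exI[of _ "qs @ [p ^ e]"]) auto
  qed
qed

section \<open>Uniqueness of the type\<close>

text \<open>As n varies, these numbers determine a finite abelian group up to isomorphism; they are
  the invariant behind the uniqueness of the moduli.\<close>

definition torsion_count :: "('a, 'm) monoid_scheme \<Rightarrow> nat \<Rightarrow> nat" where
  "torsion_count G n = card {x \<in> carrier G. x [^]\<^bsub>G\<^esub> n = \<one>\<^bsub>G\<^esub>}"

lemma iso_pow_eq_one_iff:
  assumes "h \<in> iso G H" "group G" "group H" "x \<in> carrier G"
  shows "h x [^]\<^bsub>H\<^esub> (n::nat) = \<one>\<^bsub>H\<^esub> \<longleftrightarrow> x [^]\<^bsub>G\<^esub> n = \<one>\<^bsub>G\<^esub>"
proof -
  interpret group_hom G H h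
    using assms by (simp add: group_hom_def group_hom_axioms_def iso_def)
  have inj: "inj_on h (carrier G)" using assms(1) by (simp add: iso_def bij_betw_def)
  have "h x [^]\<^bsub>H\<^esub> n = \<one>\<^bsub>H\<^esub> \<longleftrightarrow> h (x [^]\<^bsub>G\<^esub> n) = h \<one>\<^bsub>G\<^esub>"
    using assms(4) by (simp add: hom_nat_pow)
  also have "\<dots> \<longleftrightarrow> x [^]\<^bsub>G\<^esub> n = \<one>\<^bsub>G\<^esub>"
    using inj assms(4) by (intro inj_on_eq_iff) auto
  finally show ?thesis .
qed

lemma torsion_count_iso:
  assumes "G \<cong> H" "group G" "group H"
  shows "torsion_count G n = torsion_count H n"
proof -
  obtain h where h: "h \<in> iso G H" using assms(1) by (auto simp: is_iso_def)
  have b: "bij_betw h (carrier G) (carrier H)" using h by (simp add: iso_def)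
  have "bij_betw h {x \<in> carrier G. x [^]\<^bsub>G\<^esub> n = \<one>\<^bsub>G\<^esub>} {x \<in> carrier H. x [^]\<^bsub>H\<^esub> n = \<one>\<^bsub>H\<^esub>}"
    unfolding bij_betw_def
  proof
    show "inj_on h {x \<in> carrier G. x [^]\<^bsub>G\<^esub> n = \<one>\<^bsub>G\<^esub>}"
      using b unfolding bij_betw_def by (blast intro: inj_on_subset)
    have im: "h ` carrier G = carrier H" using b by (simp add: bij_betw_def)
    show "h ` {x \<in> carrier G. x [^]\<^bsub>G\<^esub> n = \<one>\<^bsub>G\<^esub>} = {x \<in> carrier H. x [^]\<^bsub>H\<^esub> n = \<one>\<^bsub>H\<^esub>}"
    proof (intro equalityI subsetI)
      fix y assume "y \<in> {x \<in> carrier H. x [^]\<^bsub>H\<^esub> n = \<one>\<^bsub>H\<^esub>}"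
      moreover from this obtain x where "x \<in> carrier G" "y = h x" using im by auto
      ultimately show "y \<in> h ` {x \<in> carrier G. x [^]\<^bsub>G\<^esub> n = \<one>\<^bsub>G\<^esub>}"
        by (simp add: iso_pow_eq_one_iff[OF h assms(2,3)])
    qed (use im in \<open>auto simp: iso_pow_eq_one_iff[OF h assms(2,3)]\<close>)
  qed
  then show ?thesis unfolding torsion_count_def by (rule bij_betw_same_card)
qed

lemma product_group_pow:
  "x [^]\<^bsub>product_group I G\<^esub> (n::nat) = (\<lambda>i\<in>I. x i [^]\<^bsub>G i\<^esub> n)"
  by (induction n) (auto intro!: restrict_ext simp: nat_pow_def)

lemma cyclic_product_pow_eq_one_iff:
  assumes "0 \<notin> set qs"
  shows "x [^]\<^bsub>cyclic_product qs\<^esub> (n::nat) = \<one>\<^bsub>cyclic_product qs\<^esub> \<longleftrightarrow>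
    (\<forall>i<length qs. int (qs ! i) dvd int n * x i)"
proof -
  have "x [^]\<^bsub>cyclic_product qs\<^esub> n = \<one>\<^bsub>cyclic_product qs\<^esub> \<longleftrightarrow>
      (\<lambda>i\<in>{..<length qs}. (int n * x i) mod int (qs ! i)) = (\<lambda>i\<in>{..<length qs}. 0)"
    by (simp add: cyclic_product_def product_group_pow)
  also have "\<dots> \<longleftrightarrow> (\<forall>i<length qs. (int n * x i) mod int (qs ! i) = 0)"
    by (metis (no_types, lifting) lessThan_iff restrict_apply' restrict_ext)
  finally show ?thesis by (simp add: dvd_eq_mod_eq_0)
qed

text \<open>Writing q = v g with g = gcd(n, q), the condition becomes divisibility of y by v, and
  there are g multiples of v in the range from 0 to q - 1.\<close>

lemma card_int_torsion:
  assumes q: "q > 0"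
  shows "card {y \<in> {0..<int q}. int q dvd int n * y} = gcd n q"
proof -
  define g where "g = gcd n q"
  have g: "g > 0" using q by (simp add: g_def)
  obtain u v where uv: "n = u * g" "q = v * g" "coprime u v"
    using gcd_coprime_exists[of n q] g unfolding g_def by auto
  have v: "v > 0" using uv q by (cases v) auto
  have iff: "int q dvd int n * y \<longleftrightarrow> int v dvd y" for y
  proof -
    have "int q dvd int n * y \<longleftrightarrow> int v * int g dvd (int u * y) * int g"
      by (simp add: uv mult_ac)
    also have "\<dots> \<longleftrightarrow> int v dvd int u * y" using g by simp
    also have "\<dots> \<longleftrightarrow> int v dvd y"
      using uv(3) by (simp add: coprime_dvd_mult_right_iff coprime_commute)
    finally show ?thesis .
  qed
  have "bij_betw (\<lambda>t. int v * t) {0..<int g} {y \<in> {0..<int q}. int q dvd int n * y}"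
  proof (rule bij_betw_imageI)
    show "inj_on (\<lambda>t. int v * t) {0..<int g}" using v by (auto simp: inj_on_def)
    show "(\<lambda>t. int v * t) ` {0..<int g} = {y \<in> {0..<int q}. int q dvd int n * y}"
      unfolding iff
    proof (intro equalityI subsetI)
      fix y assume "y \<in> (\<lambda>t. int v * t) ` {0..<int g}"
      then obtain t where "y = int v * t" "t \<in> {0..<int g}" by blast
      then have t: "y = int v * t" "0 \<le> t" "t < int g" by auto
      then have "int v * t < int v * int g" using v by (intro mult_strict_left_mono) auto
      then show "y \<in> {y \<in> {0..<int q}. int v dvd y}" using t by (simp add: uv(2))
    next
      fix y assume y: "y \<in> {y \<in> {0..<int q}. int v dvd y}"
      then obtain t where t: "y = int v * t" by (auto elim: dvdE)
      have "0 \<le> int v * t" "int v * t < int v * int g" using y t by (simp_all add: uv(2))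
      then have "t \<ge> 0" "t < int g" using v by (auto simp: zero_le_mult_iff mult_less_cancel_left_pos)
      then show "y \<in> (\<lambda>t. int v * t) ` {0..<int g}" using t by auto
    qed
  qed
  from bij_betw_same_card[OF this] show ?thesis by (simp add: g_def)
qed

lemma torsion_count_cyclic_product:
  assumes "0 \<notin> set qs"
  shows "torsion_count (cyclic_product qs) n = (\<Prod>q\<leftarrow>qs. gcd n q)"
proof -
  have "{x \<in> carrier (cyclic_product qs). x [^]\<^bsub>cyclic_product qs\<^esub> n = \<one>\<^bsub>cyclic_product qs\<^esub>}
      = (\<Pi>\<^sub>E i\<in>{..<length qs}. {y \<in> {0..<int (qs ! i)}. int (qs ! i) dvd int n * y})"
    unfolding carrier_cyclic_product[OF assms] cyclic_product_pow_eq_one_iff[OF assms]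
    by (simp only: set_eq_iff mem_Collect_eq PiE_iff lessThan_iff) blast
  then have "torsion_count (cyclic_product qs) n
      = (\<Prod>i<length qs. card {y \<in> {0..<int (qs ! i)}. int (qs ! i) dvd int n * y})"
    by (simp add: torsion_count_def card_PiE)
  also have "\<dots> = (\<Prod>i<length qs. gcd n (qs ! i))"
  proof (rule prod.cong)
    fix i assume "i \<in> {..<length qs}"
    then have "qs ! i > 0" using assms by (metis gr0I lessThan_iff nth_mem)
    then show "card {y \<in> {0..<int (qs ! i)}. int (qs ! i) dvd int n * y} = gcd n (qs ! i)"
      by (rule card_int_torsion)
  qed simp
  also have "\<dots> = (\<Prod>q\<leftarrow>qs. gcd n q)"
    by (simp add: prod.list_conv_set_nth atLeast0LessThan)
  finally show ?thesis .
qed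

text \<open>Consequently the quotient of the torsion counts at p^(k+1) and at p^k is p raised to the
  number of moduli divisible by p^(k+1).\<close>

lemma gcd_prime_power_Suc:
  fixes p q :: nat
  assumes p: "prime p"
  shows "gcd (p ^ Suc k) q = (if p ^ Suc k dvd q then p else 1) * gcd (p ^ k) q"
proof (cases "p ^ Suc k dvd q")
  case True
  then have "p ^ k dvd q" by (meson dvd_trans le_imp_power_dvd le_SucI order_refl)
  with True show ?thesis by (simp add: gcd_proj1_iff)
next
  case False
  obtain i where i: "i \<le> Suc k" "gcd (p ^ Suc k) q = p ^ i"
    using divides_primepow_nat[OF p, of "gcd (p ^ Suc k) q" "Suc k"] by auto
  have "i \<noteq> Suc k" using False i by (metis gcd_dvd2)
  then have "p ^ i dvd p ^ k" using i by (intro le_imp_power_dvd) auto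
  then have "gcd (p ^ Suc k) q dvd gcd (p ^ k) q" using i by (metis gcd_dvd2 gcd_greatest)
  moreover have "gcd (p ^ k) q dvd gcd (p ^ Suc k) q"
    by (rule gcd_mono) (auto intro: le_imp_power_dvd)
  ultimately have "gcd (p ^ Suc k) q = gcd (p ^ k) q" by (rule dvd_antisym)
  with False show ?thesis by (simp del: power_Suc)
qed

lemma prod_list_gcd_prime_power_Suc:
  fixes p :: nat
  assumes "prime p"
  shows "(\<Prod>q\<leftarrow>qs. gcd (p ^ Suc k) q)
    = p ^ length (filter (\<lambda>q. p ^ Suc k dvd q) qs) * (\<Prod>q\<leftarrow>qs. gcd (p ^ k) q)"
  by (induction qs) (simp_all add: gcd_prime_power_Suc[OF assms] del: power_Suc, simp)

text \<open>A prime power divisible by p^k but not by p^(k+1) is p^k itself. For this k has to be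
  positive, so that divisibility by p^k reveals the prime.\<close>

lemma count_primepow_list:
  fixes p :: nat
  assumes p: "prime p" and k: "k > 0" and qs: "\<forall>q\<in>set qs. primepow q"
  shows "length (filter (\<lambda>q. p ^ k dvd q) qs)
    = count (mset qs) (p ^ k) + length (filter (\<lambda>q. p ^ Suc k dvd q) qs)"
  using qs
proof (induction qs)
  case (Cons q qs)
  then obtain l j where q: "prime l" "j > 0" "q = l ^ j" by (auto simp: primepow_def)
  have 1: "p ^ i dvd q \<longleftrightarrow> l = p \<and> i \<le> j" if "i > 0" for i
  proof
    assume d: "p ^ i dvd q"
    then have "p dvd l ^ j" using q that by (metis dvd_power dvd_trans)
    then have "p dvd l" using p prime_dvd_power by blast
    then have "l = p" using primes_dvd_imp_eq[OF p q(1)] by simp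
    with d q p show "l = p \<and> i \<le> j" using power_dvd_imp_le[of p i j] prime_gt_1_nat[OF p] by simp
  qed (use q in \<open>auto intro: le_imp_power_dvd\<close>)
  have 2: "q = p ^ k \<longleftrightarrow> l = p \<and> k = j"
    using 1[of k] 1[of j] q k p by (metis dvd_refl prime_power_inj')
  show ?case using Cons 1[of k] 1[of "Suc k"] 2 k by auto
qed simp

text \<open>Quotients of consecutive products give, for every prime p and k > 0, the number of
  moduli divisible by p^k; the differences of these numbers are the multiplicities of the
  p^k.\<close>

lemma mset_eq_if_torsion_eq:
  fixes qs qs' :: "nat list"
  assumes qs: "\<forall>q\<in>set qs. primepow q" and qs': "\<forall>q\<in>set qs'. primepow q"
    and eq: "\<And>n. (\<Prod>q\<leftarrow>qs. gcd n q) = (\<Prod>q\<leftarrow>qs'. gcd n q)"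
  shows "mset qs = mset qs'"
proof (rule multiset_eqI)
  fix x
  have pos: "(\<Prod>q\<leftarrow>ls. gcd n q) > 0" if "\<forall>q\<in>set ls. primepow q" for ls :: "nat list" and n
    using that by (induction ls) (auto simp: primepow_gt_0_nat)
  have len: "length (filter (\<lambda>q. p ^ k dvd q) qs) = length (filter (\<lambda>q. p ^ k dvd q) qs')"
    if p: "prime p" and k0: "k > 0" for p k
  proof -
    obtain j where k: "k = Suc j" using gr0_implies_Suc[OF k0] by blast
    have "p ^ length (filter (\<lambda>q. p ^ k dvd q) qs) * (\<Prod>q\<leftarrow>qs. gcd (p ^ j) q) =
      p ^ length (filter (\<lambda>q. p ^ k dvd q) qs') * (\<Prod>q\<leftarrow>qs. gcd (p ^ j) q)"
      using prod_list_gcd_prime_power_Suc[OF p, of j qs] prod_list_gcd_prime_power_Suc[OF p, of j qs']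
        eq[of "p ^ Suc j"] eq[of "p ^ j"] unfolding k by simp
    then have "p ^ length (filter (\<lambda>q. p ^ k dvd q) qs) = p ^ length (filter (\<lambda>q. p ^ k dvd q) qs')"
      using pos[OF qs, of "p ^ j"] by simp
    then show ?thesis using prime_gt_1_nat[OF p] by (simp add: power_inject_exp)
  qed
  show "count (mset qs) x = count (mset qs') x"
  proof (cases "primepow x")
    case True
    then obtain p k where x: "prime p" "k > 0" "x = p ^ k" by (auto simp: primepow_def)
    then show ?thesis
      using count_primepow_list[OF x(1,2) qs] count_primepow_list[OF x(1,2) qs']
        len[of p k] len[of p "Suc k"] by simp
  next
    case False
    then have "x \<notin># mset qs" "x \<notin># mset qs'" using qs qs' by auto
    then show ?thesis by (metis not_in_iff)
  qed
qed

lemma primepow_list_no_0: "\<forall>q\<in>set qs. primepow q \<Longrightarrow> 0 \<notin> set (qs :: nat list)"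
  by (auto dest: primepow_gt_0_nat)

theorem cyclic_product_iso_imp_mset_eq:
  assumes "\<forall>q\<in>set qs. primepow q" "\<forall>q\<in>set qs'. primepow q"
    and "cyclic_product qs \<cong> cyclic_product qs'"
  shows "mset qs = mset qs'"
proof (rule mset_eq_if_torsion_eq[OF assms(1,2)])
  show "(\<Prod>q\<leftarrow>qs. gcd n q) = (\<Prod>q\<leftarrow>qs'. gcd n q)" for n
    using torsion_count_iso[OF assms(3), of n] assms(1,2)
    by (simp add: torsion_count_cyclic_product primepow_list_no_0)
qed

section \<open>Types of abelian p-groups\<close>

lemma primepow_power_list:
  assumes "prime p" "0 \<notin> set as"
  shows "\<forall>q\<in>set (map (\<lambda>a. p ^ a) as). primepow (q::nat)"
  using assms by (auto simp: primepow_prime_power gr0_conv_Suc) (metis not0_implies_Suc)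

lemma abelian_p_group_type_unique:
  assumes p: "prime p" and as: "sorted as" "0 \<notin> set as" and bs: "sorted bs" "0 \<notin> set bs"
    and iso: "abelian_p_group p as \<cong> abelian_p_group p bs"
  shows "as = bs"
proof -
  have "mset (map (\<lambda>a. p ^ a) as) = mset (map (\<lambda>a. p ^ a) bs)"
    using iso as bs primepow_power_list[OF p] unfolding abelian_p_group_eq
    by (intro cyclic_product_iso_imp_mset_eq) auto
  then have "image_mset (\<lambda>a. p ^ a) (mset as) = image_mset (\<lambda>a. p ^ a) (mset bs)" by simp
  moreover have "inj (\<lambda>a. p ^ a)"
    using prime_gt_1_nat[OF p] by (auto simp: inj_on_def)
  ultimately have "mset as = mset bs"
    using multiset.inj_map[of "\<lambda>a. p ^ a"] by (simp add: inj_eq)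
  then show ?thesis using as bs by (metis properties_for_sort)
qed

text \<open>This is the test element for exponents: its n-th power is trivial only if every modulus
  divides n. Prime powers exceed 1, so 1 is a reduced residue for each of them.\<close>

lemma all_ones_in_cyclic_product:
  assumes "\<forall>q\<in>set qs. primepow q"
  shows "(\<lambda>i\<in>{..<length qs}. 1) \<in> carrier (cyclic_product qs)"
proof -
  have "qs ! i > 1" if "i < length qs" for i
    using assms that nth_mem primepow_gt_Suc_0 by fastforce
  then show ?thesis
    unfolding carrier_cyclic_product[OF primepow_list_no_0[OF assms]] by (auto simp: PiE_iff)
qed

text \<open>Some power p^k annihilates the preimage of the all-ones element. So every modulus of a
  cyclic decomposition divides p^k and is a positive power of \<open>p\<close>.\<close>

lemma exists_p_type:
  assumes p: "prime p" and G: "comm_group G" "finite (carrier G)"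
    and tors: "\<And>x. x \<in> carrier G \<Longrightarrow> \<exists>k::nat. x [^]\<^bsub>G\<^esub> (p ^ k) = \<one>\<^bsub>G\<^esub>"
  shows "\<exists>as. sorted as \<and> 0 \<notin> set as \<and> G \<cong> abelian_p_group p as"
proof -
  obtain qs where qs: "\<forall>q\<in>set qs. primepow q" "G \<cong> cyclic_product qs"
    using finite_comm_group_iso_cyclic_product[OF G] by blast
  have grp: "group G" using G by (simp add: comm_group.axioms)
  note no0 = primepow_list_no_0[OF qs(1)]
  obtain h where h: "h \<in> iso G (cyclic_product qs)" using qs by (auto simp: is_iso_def)
  obtain x where x: "x \<in> carrier G" "h x = (\<lambda>i\<in>{..<length qs}. 1)"
    using h all_ones_in_cyclic_product[OF qs(1)] unfolding iso_def bij_betw_def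
    by (smt (verit) imageE mem_Collect_eq)
  obtain k where "x [^]\<^bsub>G\<^esub> (p ^ k) = \<one>\<^bsub>G\<^esub>" using tors[OF x(1)] by blast
  then have "h x [^]\<^bsub>cyclic_product qs\<^esub> (p ^ k) = \<one>\<^bsub>cyclic_product qs\<^esub>"
    using iso_pow_eq_one_iff[OF h grp group_cyclic_product x(1)] by simp
  then have dv: "\<forall>i<length qs. int (qs ! i) dvd int (p ^ k)"
    unfolding x(2) cyclic_product_pow_eq_one_iff[OF no0] by simp
  have "\<exists>a>0. q = p ^ a" if "q \<in> set qs" for q
  proof -
    have "q dvd p ^ k" using dv that by (metis in_set_conv_nth int_dvd_int_iff)
    then obtain a where a: "q = p ^ a" using divides_primepow_nat[OF p] by blast
    have "q \<noteq> 1" using qs(1) that by auto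
    with a have "a \<noteq> 0" by (metis power_0)
    with a show ?thesis by auto
  qed
  then obtain f where f: "\<And>q. q \<in> set qs \<Longrightarrow> f q > 0 \<and> q = p ^ f q" by metis
  define as where "as = sort (map f qs)"
  have "0 \<notin> set as" using f unfolding as_def by fastforce
  moreover have "map (\<lambda>a. p ^ a) (map f qs) = qs"
    using f by (auto simp: map_idI)
  then have "mset (map (\<lambda>a. p ^ a) as) = mset qs"
    by (metis as_def mset_map mset_sort)
  then have "cyclic_product qs \<cong> abelian_p_group p as"
    unfolding abelian_p_group_eq by (intro cyclic_product_perm) simp
  then have "G \<cong> abelian_p_group p as" using qs(2) iso_trans by blast
  moreover have "sorted as" by (simp add: as_def)
  ultimately show ?thesis by blast
qed

text \<open>Existence and uniqueness of the type together justify the definite description in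
  \<open>p_type\<close>.\<close>

lemma p_type_spec:
  assumes p: "prime p" and G: "comm_group G" "finite (carrier G)"
    and tors: "\<And>x. x \<in> carrier G \<Longrightarrow> \<exists>k::nat. x [^]\<^bsub>G\<^esub> (p ^ k) = \<one>\<^bsub>G\<^esub>"
  shows "sorted (p_type p G) \<and> 0 \<notin> set (p_type p G) \<and> G \<cong> abelian_p_group p (p_type p G)"
proof -
  obtain as where as: "sorted as \<and> 0 \<notin> set as \<and> G \<cong> abelian_p_group p as"
    using exists_p_type[OF assms] by blast
  show ?thesis unfolding p_type_def
  proof (rule theI[of _ as])
    fix bs assume bs: "sorted bs \<and> 0 \<notin> set bs \<and> G \<cong> abelian_p_group p bs"
    have "group G" using G by (simp add: comm_group.axioms)
    then have "abelian_p_group p bs \<cong> G" using bs group.iso_sym by blast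
    then have "abelian_p_group p bs \<cong> abelian_p_group p as" using as iso_trans by blast
    then show "bs = as" using abelian_p_group_type_unique[OF p] as bs by blast
  qed (rule as)
qed

section \<open>Rank of the conjugate group\<close>

text \<open>The carrier itself is a finite generating set, so the least number in
  \<open>group_rank\<close> is attained.\<close>

lemma group_rank_le_iff:
  assumes "group G" "finite (carrier G)"
  shows "group_rank G \<le> r \<longleftrightarrow>
    (\<exists>S\<subseteq>carrier G. finite S \<and> card S \<le> r \<and> generate G S = carrier G)"
proof
  let ?P = "\<lambda>n. \<exists>S\<subseteq>carrier G. finite S \<and> card S = n \<and> generate G S = carrier G"
  have "generate G (carrier G) = carrier G"
    using group.generate_incl[OF assms(1), of "carrier G"] by (auto intro: generate.incl)
  then have "?P (card (carrier G))" using assms(2) by blast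
  then have "?P (group_rank G)" unfolding group_rank_def by (rule LeastI)
  then show "group_rank G \<le> r \<Longrightarrow>
      \<exists>S\<subseteq>carrier G. finite S \<and> card S \<le> r \<and> generate G S = carrier G" by auto
next
  assume "\<exists>S\<subseteq>carrier G. finite S \<and> card S \<le> r \<and> generate G S = carrier G"
  then obtain S where S: "S \<subseteq> carrier G" "finite S" "card S \<le> r" "generate G S = carrier G" by blast
  have "group_rank G \<le> card S" unfolding group_rank_def by (rule Least_le) (use S in blast)
  with S(3) show "group_rank G \<le> r" by linarith
qed

section \<open>Generators of a direct sum of p-groups\<close>

lemma carrier_abelian_p_group:
  assumes "p > 0"
  shows "carrier (abelian_p_group p as) = (\<Pi>\<^sub>E i\<in>{..<length as}. {0..<int (p ^ (as ! i))})"
proof -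
  have "0 \<notin> set (map (\<lambda>a. p ^ a) as)" using assms by auto
  then show ?thesis unfolding abelian_p_group_eq by (auto simp: carrier_cyclic_product PiE_iff)
qed

lemma group_abelian_p_group [simp]: "group (abelian_p_group p as)"
  by (simp add: abelian_p_group_eq)

text \<open>The conjugate group is the instance where \<open>bs p\<close> is the conjugate of the
  type at \<open>p\<close>. As no part is 0, every listed summand is nontrivial and
  \<open>length (bs p)\<close> is the rank at \<open>p\<close>.\<close>

locale sum_of_p_groups =
  fixes Ps :: "nat set" and bs :: "nat \<Rightarrow> nat list"
  assumes finite_Ps: "finite Ps" and prime_Ps: "\<And>p. p \<in> Ps \<Longrightarrow> prime p"
    and no_zero: "\<And>p. p \<in> Ps \<Longrightarrow> 0 \<notin> set (bs p)"
begin

definition S :: "(nat \<Rightarrow> nat \<Rightarrow> int) monoid" where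
  "S = product_group Ps (\<lambda>p. abelian_p_group p (bs p))"

abbreviation modulus :: "nat \<Rightarrow> nat \<Rightarrow> int" where
  "modulus p i \<equiv> int (p ^ (bs p ! i))"

lemma group_S: "group S"
  by (simp add: S_def)

lemma carrier_S: "carrier S = (\<Pi>\<^sub>E p\<in>Ps. \<Pi>\<^sub>E i\<in>{..<length (bs p)}. {0..<modulus p i})"
  unfolding S_def carrier_product_group
  by (intro PiE_cong carrier_abelian_p_group) (use prime_Ps prime_gt_0_nat in blast)

lemma finite_S: "finite (carrier S)"
  unfolding carrier_S by (intro finite_PiE finite_Ps) auto

lemma mult_S: "x \<otimes>\<^bsub>S\<^esub> y = (\<lambda>p\<in>Ps. \<lambda>i\<in>{..<length (bs p)}. (x p i + y p i) mod modulus p i)"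
  by (simp add: S_def abelian_p_group_def)

lemma one_S: "\<one>\<^bsub>S\<^esub> = (\<lambda>p\<in>Ps. \<lambda>i\<in>{..<length (bs p)}. 0)"
  by (simp add: S_def abelian_p_group_def)

lemma pow_S: "x [^]\<^bsub>S\<^esub> (n::nat) = (\<lambda>p\<in>Ps. \<lambda>i\<in>{..<length (bs p)}. (int n * x p i) mod modulus p i)"
  by (simp add: S_def abelian_p_group_def product_group_pow)

lemma coord:
  assumes "x \<in> carrier S" "p \<in> Ps" "i < length (bs p)"
  shows "x p i \<ge> 0" "x p i < modulus p i"
proof -
  have "x p \<in> (\<Pi>\<^sub>E i\<in>{..<length (bs p)}. {0..<modulus p i})"
    using assms(1,2) unfolding carrier_S by (rule PiE_mem)
  then have "x p i \<in> {0..<modulus p i}" by (rule PiE_mem) (use assms(3) in simp)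
  then show "x p i \<ge> 0" "x p i < modulus p i" by auto
qed

lemma eqI:
  assumes "x \<in> carrier S" "y \<in> carrier S"
    and "\<And>p i. p \<in> Ps \<Longrightarrow> i < length (bs p) \<Longrightarrow> x p i = y p i"
  shows "x = y"
proof (rule PiE_ext[OF assms(1)[unfolded carrier_S] assms(2)[unfolded carrier_S]])
  fix p assume p: "p \<in> Ps"
  have "x p \<in> (\<Pi>\<^sub>E i\<in>{..<length (bs p)}. {0..<modulus p i})"
    "y p \<in> (\<Pi>\<^sub>E i\<in>{..<length (bs p)}. {0..<modulus p i})"
    using assms(1,2) p unfolding carrier_S by (blast intro: PiE_mem)+
  then show "x p = y p" by (rule PiE_ext) (use assms(3) p in simp)
qed

lemma modulus_ge:
  assumes "p \<in> Ps" "i < length (bs p)"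
  shows "modulus p i \<ge> int p" "modulus p i > 1"
proof -
  have "bs p ! i \<noteq> 0" using no_zero[OF assms(1)] assms(2) by (metis nth_mem)
  then have "p ^ 1 \<le> p ^ (bs p ! i)"
    using prime_gt_0_nat[OF prime_Ps[OF assms(1)]] by (intro power_increasing) auto
  then show "modulus p i \<ge> int p" by (simp only: power_one_right of_nat_le_iff)
  with prime_gt_1_nat[OF prime_Ps[OF assms(1)]] show "modulus p i > 1" by linarith
qed

lemma tabulate_in_S:
  assumes "\<And>p i. p \<in> Ps \<Longrightarrow> i < length (bs p) \<Longrightarrow> 0 \<le> f p i \<and> f p i < modulus p i"
  shows "(\<lambda>p\<in>Ps. \<lambda>i\<in>{..<length (bs p)}. f p i) \<in> carrier S"
  unfolding carrier_S using assms by (intro restrict_PiE_iff[THEN iffD2] ballI) auto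

text \<open>For fixed j, the j-th summands at the different primes have coprime orders, so their sum
  is cyclic, with generator \<open>u j\<close>. Hence the longest list bounds the number of
  generators.\<close>

lemma exists_generators:
  assumes len: "\<And>p. p \<in> Ps \<Longrightarrow> length (bs p) \<le> r"
  shows "\<exists>T\<subseteq>carrier S. finite T \<and> card T \<le> r \<and> generate S T = carrier S"
proof -
  interpret group S by (rule group_S)
  define u where "u = (\<lambda>j. \<lambda>p\<in>Ps. \<lambda>i\<in>{..<length (bs p)}. if i = j then 1 else (0::int))"
  define T where "T = u ` {..<r}"
  have u: "u j \<in> carrier S" for j
    unfolding u_def
  proof (rule tabulate_in_S)
    fix p i assume "p \<in> Ps" "i < length (bs p)"
    then have "modulus p i > 1" by (rule modulus_ge)
    then show "0 \<le> (if i = j then 1 else (0::int)) \<and> (if i = j then 1 else 0) < modulus p i"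
      by (smt (verit))
  qed
  then have T: "T \<subseteq> carrier S" by (auto simp: T_def)
  interpret gen: subgroup "generate S T" S by (rule generate_is_subgroup[OF T])
  have "carrier S \<subseteq> generate S T"
  proof
    fix t assume t: "t \<in> carrier S"
    \<comment> \<open>\<open>w n\<close> keeps the first n positions of \<open>t\<close> at every
      prime; the induction generates \<open>t\<close> one position at a time.\<close>
    define w where "w = (\<lambda>n. \<lambda>p\<in>Ps. \<lambda>i\<in>{..<length (bs p)}. if i < n then t p i else 0)"
    have w: "w n \<in> carrier S" for n
      unfolding w_def
    proof (rule tabulate_in_S)
      fix p i assume "p \<in> Ps" "i < length (bs p)"
      from coord[OF t this]
      show "0 \<le> (if i < n then t p i else 0) \<and> (if i < n then t p i else 0) < modulus p i"
        by (smt (verit))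
    qed
    have "w n \<in> generate S T" if "n \<le> r" for n
      using that
    proof (induction n)
      case 0
      have "w 0 = \<one>\<^bsub>S\<^esub>" by (simp add: w_def one_S)
      then show ?case by simp
    next
      case (Suc n)
      let ?A = "{p \<in> Ps. n < length (bs p)}"
      \<comment> \<open>The Chinese remainder theorem yields one exponent of \<open>u n\<close> that serves all primes.\<close>
      have "\<exists>k. \<forall>p\<in>?A. [k = nat (t p n)] (mod p ^ (bs p ! n))"
      proof (rule chinese_remainder_nat)
        show "finite ?A" using finite_Ps by simp
        show "\<forall>p\<in>?A. \<forall>q\<in>?A. p \<noteq> q \<longrightarrow> coprime (p ^ (bs p ! n)) (q ^ (bs q ! n))"
          using prime_Ps by (auto simp: primes_coprime)
      qed
      then obtain k where k: "\<And>p. p \<in> Ps \<Longrightarrow> n < length (bs p) \<Longrightarrow> [k = nat (t p n)] (mod p ^ (bs p ! n))"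
        by blast
      have km: "int k mod modulus p n = t p n" if "p \<in> Ps" "n < length (bs p)" for p
      proof -
        have "[int k = int (nat (t p n))] (mod modulus p n)"
          using k[OF that] by (simp only: cong_int_iff)
        then show ?thesis using coord[OF t that] by (simp add: cong_def)
      qed
      have "w (Suc n) = w n \<otimes>\<^bsub>S\<^esub> u n [^]\<^bsub>S\<^esub> k"
      proof (rule eqI)
        fix p i assume pi: "p \<in> Ps" "i < length (bs p)"
        have m1: "t p i mod modulus p i = t p i" using coord[OF t pi] by simp
        consider "i < n" | "i = n" | "i > n" by linarith
        then show "w (Suc n) p i = (w n \<otimes>\<^bsub>S\<^esub> u n [^]\<^bsub>S\<^esub> k) p i"
        proof cases
          case 1 then show ?thesis using pi m1 by (simp add: w_def u_def mult_S pow_S)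
        next
          case 2 then show ?thesis using pi km[OF pi(1)] m1 by (simp add: w_def u_def mult_S pow_S)
        next
          case 3 then show ?thesis using pi by (simp add: w_def u_def mult_S pow_S)
        qed
      qed (use w u in auto)
      moreover have "u n \<in> generate S T" using Suc.prems by (auto simp: T_def intro: generate.incl)
      then have "u n [^]\<^bsub>S\<^esub> k \<in> generate S T"
        by (induction k) auto
      moreover have "w n \<in> generate S T" using Suc by simp
      ultimately show ?case by simp
    qed
    moreover have "w r = t"
    proof (rule eqI[OF w t])
      fix p i assume pi: "p \<in> Ps" "i < length (bs p)"
      then have "i < r" using len[of p] by linarith
      with pi show "w r p i = t p i" by (simp add: w_def)
    qed
    ultimately show "t \<in> generate S T" by force
  qed
  then have "generate S T = carrier S" using gen.subset by blast
  moreover have "card T \<le> r" unfolding T_def using card_image_le[of "{..<r}" u] by simp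
  moreover have "finite T" by (simp add: T_def)
  ultimately show ?thesis using T by blast
qed

text \<open>This is the dimension bound for the reduction of the p-part modulo p, carried out by
  counting: all p^m residue vectors, m being the length, are combinations of the generators with
  coefficients from 0 to p - 1, and there are only p^(card T) choices of such coefficients.\<close>

lemma length_le_card_generators:
  assumes T: "T \<subseteq> carrier S" "finite T" and gen: "generate S T = carrier S" and p: "p \<in> Ps"
  shows "length (bs p) \<le> card T"
proof -
  interpret group S by (rule group_S)
  have p1: "p > 1" using prime_gt_1_nat[OF prime_Ps[OF p]] .
  let ?m = "length (bs p)"
  have pdvd: "int p dvd modulus p i" if "i < ?m" for i
  proof -
    have "bs p ! i \<noteq> 0" using no_zero[OF p] that by (metis nth_mem)
    then show ?thesis by (simp add: dvd_power)
  qed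
  have mm: "[z mod modulus p i = z] (mod int p)" if "i < ?m" for i z
    using pdvd[OF that] by (metis cong_def mod_mod_cancel)
  \<comment> \<open>All moduli at \<open>p\<close> are multiples of \<open>p\<close>, so the group
    operation, although reduced modulo a power of \<open>p\<close>, is additive modulo
    \<open>p\<close>.\<close>
  have comb: "\<exists>e. \<forall>i<?m. [x p i = (\<Sum>s\<in>T. e s * s p i)] (mod int p)" if "x \<in> generate S T" for x
    using that
  proof induction
    case one
    have "\<forall>i<?m. [\<one>\<^bsub>S\<^esub> p i = (\<Sum>s\<in>T. 0 * s p i)] (mod int p)" using p by (simp add: one_S)
    then show ?case by (rule exI[of _ "\<lambda>_. 0"])
  next
    case (incl h)
    have "h p i = (\<Sum>s\<in>T. (if s = h then 1 else 0) * s p i)" for i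
    proof -
      have "(\<Sum>s\<in>T. (if s = h then 1 else 0) * s p i) = (\<Sum>s\<in>T. if s = h then h p i else 0)"
        by (intro sum.cong) auto
      then show ?thesis using incl T(2) by simp
    qed
    then show ?case by (intro exI[of _ "\<lambda>s. if s = h then 1 else 0"]) simp
  next
    case (inv h)
    have hS: "h \<in> carrier S" using inv T by blast
    have ih: "[(inv\<^bsub>S\<^esub> h) p i = - h p i] (mod int p)" if i: "i < ?m" for i
    proof -
      have "(inv\<^bsub>S\<^esub> h \<otimes>\<^bsub>S\<^esub> h) p i = 0" using hS p i by (simp add: one_S)
      then have "((inv\<^bsub>S\<^esub> h) p i + h p i) mod modulus p i = 0" using p i by (simp add: mult_S)
      then have "modulus p i dvd (inv\<^bsub>S\<^esub> h) p i + h p i" by (simp add: dvd_eq_mod_eq_0)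
      then have "int p dvd (inv\<^bsub>S\<^esub> h) p i + h p i" using pdvd[OF i] dvd_trans by blast
      then show ?thesis by (simp add: cong_iff_dvd_diff)
    qed
    have "- h p i = (\<Sum>s\<in>T. (if s = h then - 1 else 0) * s p i)" for i
    proof -
      have "(\<Sum>s\<in>T. (if s = h then - 1 else 0) * s p i) = (\<Sum>s\<in>T. if s = h then - h p i else 0)"
        by (intro sum.cong) auto
      then show ?thesis using inv T(2) by simp
    qed
    with ih show ?case by (intro exI[of _ "\<lambda>s. if s = h then - 1 else 0"]) simp
  next
    case (eng x y)
    then obtain e f where e: "\<forall>i<?m. [x p i = (\<Sum>s\<in>T. e s * s p i)] (mod int p)"
      and f: "\<forall>i<?m. [y p i = (\<Sum>s\<in>T. f s * s p i)] (mod int p)" by blast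
    have "[(x \<otimes>\<^bsub>S\<^esub> y) p i = (\<Sum>s\<in>T. (e s + f s) * s p i)] (mod int p)" if i: "i < ?m" for i
    proof -
      have "[(x \<otimes>\<^bsub>S\<^esub> y) p i = x p i + y p i] (mod int p)"
        using mm[OF i, of "x p i + y p i"] p i by (simp add: mult_S)
      also have "[x p i + y p i = (\<Sum>s\<in>T. e s * s p i) + (\<Sum>s\<in>T. f s * s p i)] (mod int p)"
        using e f i by (intro cong_add) auto
      finally show ?thesis by (simp add: sum.distrib distrib_right)
    qed
    then show ?case by (intro exI[of _ "\<lambda>s. e s + f s"] allI impI)
  qed
  let ?D = "\<Pi>\<^sub>E i\<in>{..<?m}. {0..<int p}" and ?E = "\<Pi>\<^sub>E s\<in>T. {0..<int p}"
  let ?\<psi> = "\<lambda>e. \<lambda>i\<in>{..<?m}. (\<Sum>s\<in>T. e s * s p i) mod int p"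
  have "?D \<subseteq> ?\<psi> ` ?E"
  proof
    fix y assume y: "y \<in> ?D"
    have y_i: "0 \<le> y i" "y i < int p" if "i < ?m" for i
      using PiE_mem[OF y, of i] that by auto
    \<comment> \<open>A residue vector is lifted to an element that vanishes at all other primes;
      its entries lie below p and hence below every modulus at \<open>p\<close>.\<close>
    define x where "x = (\<lambda>q\<in>Ps. \<lambda>i\<in>{..<length (bs q)}. if q = p then y i else 0)"
    have "x \<in> carrier S"
      unfolding x_def
    proof (rule tabulate_in_S)
      fix q i assume q: "q \<in> Ps" "i < length (bs q)"
      show "0 \<le> (if q = p then y i else 0) \<and> (if q = p then y i else 0) < modulus q i"
      proof (cases "q = p")
        case True
        then show ?thesis using y_i[of i] modulus_ge(1)[OF q] q by (simp del: of_nat_power)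
      next
        case False
        then show ?thesis using modulus_ge(2)[OF q] by (simp only: if_False; linarith)
      qed
    qed
    then obtain e where e: "\<And>i. i < ?m \<Longrightarrow> [x p i = (\<Sum>s\<in>T. e s * s p i)] (mod int p)"
      using comb gen by blast
    define e' where "e' = (\<lambda>s\<in>T. e s mod int p)"
    have "e' \<in> ?E" using p1 by (auto simp: e'_def)
    moreover have "y = ?\<psi> e'"
    proof (rule PiE_ext[OF y])
      show "?\<psi> e' \<in> ?D" using p1 by auto
      fix i assume "i \<in> {..<?m}"
      then have i: "i < ?m" by simp
      have "[(\<Sum>s\<in>T. e s * s p i) = (\<Sum>s\<in>T. e' s * s p i)] (mod int p)"
        by (intro cong_sum cong_mult) (auto simp: e'_def cong_def)
      with e[OF i] have "[y i = (\<Sum>s\<in>T. e' s * s p i)] (mod int p)"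
        using i p by (auto simp: x_def intro: cong_trans)
      then show "y i = ?\<psi> e' i" using i y_i[OF i] by (simp add: cong_def)
    qed
    ultimately show "y \<in> ?\<psi> ` ?E" by blast
  qed
  moreover have fE: "finite ?E" using T(2) by (intro finite_PiE) auto
  ultimately have "card ?D \<le> card ?E"
    by (meson card_image_le card_mono finite_imageI order_trans)
  then have "p ^ ?m \<le> p ^ card T" using T(2) by (simp add: card_PiE)
  then show ?thesis using p1 by (simp add: power_increasing_iff)
qed

lemma group_rank_S_le_iff: "group_rank S \<le> r \<longleftrightarrow> (\<forall>p\<in>Ps. length (bs p) \<le> r)"
proof
  assume "group_rank S \<le> r"
  then obtain T where T: "T \<subseteq> carrier S" "finite T" "card T \<le> r" "generate S T = carrier S"
    using group_rank_le_iff[OF group_S finite_S] by blast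
  show "\<forall>p\<in>Ps. length (bs p) \<le> r"
    using length_le_card_generators[OF T(1,2,4)] T(3) by (blast intro: order_trans)
next
  assume "\<forall>p\<in>Ps. length (bs p) \<le> r"
  then show "group_rank S \<le> r"
    by (simp add: group_rank_le_iff[OF group_S finite_S] exists_generators)
qed

end

text \<open>The condition that p^r annihilates each p-primary component is phrased through elements
  of the group itself, so that it transfers directly along isomorphisms and to direct
  factors.\<close>

definition exponent_bounded :: "nat \<Rightarrow> ('a, 'm) monoid_scheme \<Rightarrow> bool" where
  "exponent_bounded r G \<longleftrightarrow> (\<forall>p::nat. prime p \<longrightarrow> (\<forall>x\<in>carrier G. \<forall>k::nat.
     x [^]\<^bsub>G\<^esub> (p ^ k) = \<one>\<^bsub>G\<^esub> \<longrightarrow> x [^]\<^bsub>G\<^esub> (p ^ r) = \<one>\<^bsub>G\<^esub>))"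

text \<open>Here the rank of the conjugate turns into an exponent: the largest part of a partition
  is the number of parts of its transpose.\<close>

lemma length_conjugate_partition:
  "length (conjugate_partition as) = Max (insert 0 (set as))"
  by (simp add: conjugate_partition_def)

text \<open>A largest part is counted for every j up to the maximum, so no count is 0.\<close>

lemma conjugate_partition_no_0: "0 \<notin> set (conjugate_partition as)"
proof
  assume "0 \<in> set (conjugate_partition as)"
  then obtain j where j: "1 \<le> j" "j \<le> Max (insert 0 (set as))"
    "card {i. i < length as \<and> j \<le> as ! i} = 0"
    by (auto simp: conjugate_partition_def)
  have "Max (insert 0 (set as)) \<in> insert 0 (set as)" by (rule Max_in) auto
  with j have "Max (insert 0 (set as)) \<in> set as" by auto
  then obtain i where "i < length as" "as ! i = Max (insert 0 (set as))"
    by (auto simp: in_set_conv_nth)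
  then have "i \<in> {i. i < length as \<and> j \<le> as ! i}" using j by simp
  moreover have "finite {i. i < length as \<and> j \<le> as ! i}" by simp
  ultimately show False using j(3) by (metis card_0_eq empty_iff)
qed

lemma iso_exponent_transfer:
  assumes "G \<cong> H" "group G" "group H"
  shows "(\<forall>x\<in>carrier G. x [^]\<^bsub>G\<^esub> (n::nat) = \<one>\<^bsub>G\<^esub>) \<longleftrightarrow> (\<forall>y\<in>carrier H. y [^]\<^bsub>H\<^esub> n = \<one>\<^bsub>H\<^esub>)"
proof -
  obtain h where h: "h \<in> iso G H" using assms(1) by (auto simp: is_iso_def)
  then have "carrier H = h ` carrier G" by (simp add: iso_def bij_betw_def)
  then show ?thesis using iso_pow_eq_one_iff[OF h assms(2,3)] by simp
qed

lemma exponent_abelian_p_group: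
  assumes p: "prime p" and as: "0 \<notin> set as"
  shows "(\<forall>x\<in>carrier (abelian_p_group p as). x [^]\<^bsub>abelian_p_group p as\<^esub> (p ^ r) = \<one>\<^bsub>abelian_p_group p as\<^esub>)
    \<longleftrightarrow> (\<forall>a\<in>set as. a \<le> r)"
proof -
  define qs where "qs = map (\<lambda>a. p ^ a) as"
  have qs: "\<forall>q\<in>set qs. primepow q" unfolding qs_def using primepow_power_list[OF p as] .
  have eq: "(\<forall>x\<in>carrier (cyclic_product qs). \<forall>i<length qs. int (qs ! i) dvd int (p ^ r) * x i)
     \<longleftrightarrow> (\<forall>i<length qs. int (qs ! i) dvd int (p ^ r))"
    using all_ones_in_cyclic_product[OF qs] by (fastforce simp del: of_nat_power)
  have "(\<forall>i<length qs. int (qs ! i) dvd int (p ^ r)) \<longleftrightarrow> (\<forall>q\<in>set qs. q dvd p ^ r)"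
    by (metis in_set_conv_nth int_dvd_int_iff)
  also have "\<dots> \<longleftrightarrow> (\<forall>a\<in>set as. a \<le> r)"
    using prime_gt_1_nat[OF p] by (auto simp: qs_def dvd_power_iff_le intro: le_imp_power_dvd)
  finally show ?thesis
    unfolding abelian_p_group_eq qs_def[symmetric]
      cyclic_product_pow_eq_one_iff[OF primepow_list_no_0[OF qs]] eq .
qed

text \<open>The rank is bounded by r iff at every prime the conjugate type has at most r parts, that
  is, iff the largest part of the type is at most r, which says that p^r annihilates the primary
  component.\<close>

lemma group_rank_conjugate_le_iff:
  assumes G: "comm_group G" "finite (carrier G)"
  shows "group_rank (conjugate_group G) \<le> r \<longleftrightarrow> exponent_bounded r G"
proof -
  interpret comm_group G by (rule G)
  let ?C = "\<lambda>p. primary_component p G"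
  let ?t = "\<lambda>p. p_type p (?C p)"
  define Ps where "Ps = {p. prime p \<and> p dvd card (carrier G)}"
  have carC: "carrier (?C p) = {x \<in> carrier G. \<exists>k::nat. x [^]\<^bsub>G\<^esub> (p ^ k) = \<one>\<^bsub>G\<^esub>}" for p
    by (simp add: primary_component_def)
  have sub: "subgroup (carrier (?C p)) G" for p
  proof (rule subgroupI)
    show "carrier (?C p) \<subseteq> carrier G" by (auto simp: carC)
    have "\<one>\<^bsub>G\<^esub> \<in> carrier (?C p)" by (auto simp: carC)
    then show "carrier (?C p) \<noteq> {}" by blast
  next
    fix x assume "x \<in> carrier (?C p)"
    then show "inv\<^bsub>G\<^esub> x \<in> carrier (?C p)" by (auto simp: carC nat_pow_inv)
  next
    fix x y assume "x \<in> carrier (?C p)" "y \<in> carrier (?C p)"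
    then obtain k l where xy: "x \<in> carrier G" "y \<in> carrier G"
      "x [^]\<^bsub>G\<^esub> (p ^ k) = \<one>\<^bsub>G\<^esub>" "y [^]\<^bsub>G\<^esub> (p ^ l) = \<one>\<^bsub>G\<^esub>" by (auto simp: carC)
    have "x [^]\<^bsub>G\<^esub> (p ^ (k + l)) = \<one>\<^bsub>G\<^esub>" "y [^]\<^bsub>G\<^esub> (p ^ (k + l)) = \<one>\<^bsub>G\<^esub>"
      using xy by (auto simp: pow_eq_id power_add)
    then have "(x \<otimes>\<^bsub>G\<^esub> y) [^]\<^bsub>G\<^esub> (p ^ (k + l)) = \<one>\<^bsub>G\<^esub>"
      using xy by (simp add: nat_pow_distrib)
    then show "x \<otimes>\<^bsub>G\<^esub> y \<in> carrier (?C p)" using xy by (auto simp: carC)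
  qed
  have Cdef: "?C p = G\<lparr>carrier := carrier (?C p)\<rparr>" for p
    by (simp add: primary_component_def)
  have grC: "group (?C p)" for p
    by (subst Cdef) (rule subgroup.subgroup_is_group[OF sub is_group])
  have powC: "x [^]\<^bsub>?C p\<^esub> (n::nat) = x [^]\<^bsub>G\<^esub> n" "\<one>\<^bsub>?C p\<^esub> = \<one>\<^bsub>G\<^esub>" for p x n
    by (simp_all add: primary_component_def nat_pow_def)
  have commC: "comm_group (?C p)" for p
  proof (rule group.group_comm_groupI[OF grC])
    fix x y assume "x \<in> carrier (?C p)" "y \<in> carrier (?C p)"
    then show "x \<otimes>\<^bsub>?C p\<^esub> y = y \<otimes>\<^bsub>?C p\<^esub> x"
      by (simp add: primary_component_def m_comm)
  qed
  have finC: "finite (carrier (?C p))" for p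
    using G(2) by (simp add: carC)
  have spec: "sorted (?t p) \<and> 0 \<notin> set (?t p) \<and> ?C p \<cong> abelian_p_group p (?t p)" if "prime p" for p
    by (rule p_type_spec[OF that commC finC]) (auto simp: carC powC)
  interpret sum_of_p_groups Ps "\<lambda>p. conjugate_partition (?t p)"
  proof
    have "card (carrier G) > 0" using G(2) one_closed card_gt_0_iff by blast
    then show "finite Ps" unfolding Ps_def by (simp add: finite_divisors_nat)
  qed (auto simp: Ps_def conjugate_partition_no_0)
  have "conjugate_group G = S"
    unfolding conjugate_group_def conjugate_p_group_def Ps_def[symmetric] S_def ..
  then have "group_rank (conjugate_group G) \<le> r \<longleftrightarrow> (\<forall>p\<in>Ps. length (conjugate_partition (?t p)) \<le> r)"
    using group_rank_S_le_iff by simp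
  also have "\<dots> \<longleftrightarrow> (\<forall>p\<in>Ps. \<forall>a\<in>set (?t p). a \<le> r)"
    by (simp add: length_conjugate_partition)
  also have "\<dots> \<longleftrightarrow> (\<forall>p\<in>Ps. \<forall>x\<in>carrier (?C p). x [^]\<^bsub>G\<^esub> (p ^ r) = \<one>\<^bsub>G\<^esub>)"
  proof (rule ball_cong)
    fix p assume "p \<in> Ps"
    then have p: "prime p" by (simp add: Ps_def)
    show "(\<forall>a\<in>set (?t p). a \<le> r) \<longleftrightarrow> (\<forall>x\<in>carrier (?C p). x [^]\<^bsub>G\<^esub> (p ^ r) = \<one>\<^bsub>G\<^esub>)"
      using exponent_abelian_p_group[OF p, of "?t p" r] spec[OF p]
        iso_exponent_transfer[of "?C p" "abelian_p_group p (?t p)" "p ^ r"] grC[of p]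
      by (simp add: powC)
  qed simp
  also have "\<dots> \<longleftrightarrow> exponent_bounded r G"
  proof
    assume L: "\<forall>p\<in>Ps. \<forall>x\<in>carrier (?C p). x [^]\<^bsub>G\<^esub> (p ^ r) = \<one>\<^bsub>G\<^esub>"
    show "exponent_bounded r G"
      unfolding exponent_bounded_def
    proof (intro allI impI ballI)
      fix p :: nat and x and k :: nat
      assume p: "prime p" and x: "x \<in> carrier G" "x [^]\<^bsub>G\<^esub> (p ^ k) = \<one>\<^bsub>G\<^esub>"
      show "x [^]\<^bsub>G\<^esub> (p ^ r) = \<one>\<^bsub>G\<^esub>"
      proof (cases "p \<in> Ps")
        case True
        then show ?thesis using L x by (auto simp: carC)
      next
        \<comment> \<open>For a prime that does not divide the order, only the identity has p-power
          order.\<close>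
        case False
        then have "\<not> p dvd card (carrier G)" using p by (simp add: Ps_def)
        then have "coprime (p ^ k) (card (carrier G))"
          using p by (simp add: prime_imp_coprime)
        moreover have "ord x dvd card (carrier G)"
          using ord_dvd_group_order[OF x(1)] by (simp add: Coset.order_def)
        moreover have "ord x dvd p ^ k" using x by (simp add: pow_eq_id)
        ultimately have "ord x = 1" by (metis coprime_common_divisor_nat)
        then show ?thesis using x(1) by (simp add: pow_eq_id)
      qed
    qed
  next
    assume "exponent_bounded r G"
    then show "\<forall>p\<in>Ps. \<forall>x\<in>carrier (?C p). x [^]\<^bsub>G\<^esub> (p ^ r) = \<one>\<^bsub>G\<^esub>"
      by (auto simp: exponent_bounded_def carC Ps_def)
  qed
  finally show ?thesis .
qed

section \<open>Isomorphism classes and tuples of integers\<close>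

lemma class_rep_in:
  assumes "C \<in> fin_ab_classes"
  shows "class_rep C \<in> C" "class_rep C \<in> fin_ab_groups"
    "H \<in> C \<longleftrightarrow> H \<in> fin_ab_groups \<and> class_rep C \<cong> H"
proof -
  from assms obtain G where G: "G \<in> fin_ab_groups" "C = fin_ab_iso `` {G}"
    unfolding fin_ab_classes_def by (elim quotientE)
  have "G \<in> C" using G equiv_class_self[OF equiv_fin_ab_iso] by simp
  then show rep: "class_rep C \<in> C" unfolding class_rep_def by (rule someI)
  then show "class_rep C \<in> fin_ab_groups" using G by (auto simp: fin_ab_iso_def)
  have "C = fin_ab_iso `` {class_rep C}"
    using rep unfolding G(2) by (intro equiv_class_eq[OF equiv_fin_ab_iso]) auto
  moreover have "class_rep C \<in> fin_ab_groups" using rep G(2) by (auto simp: fin_ab_iso_def)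
  ultimately show "H \<in> C \<longleftrightarrow> H \<in> fin_ab_groups \<and> class_rep C \<cong> H"
    by (metis (mono_tags, lifting) Image_singleton_iff case_prodD case_prodI fin_ab_iso_def mem_Collect_eq)
qed

lemma fin_ab_groupsD:
  assumes "G \<in> fin_ab_groups"
  shows "comm_group G" "group G" "finite (carrier G)"
  using assms by (auto simp: fin_ab_groups_def comm_group.axioms)

lemma class_eqI:
  assumes "C \<in> fin_ab_classes" "D \<in> fin_ab_classes" "class_rep C \<cong> class_rep D"
  shows "C = D"
proof -
  have "class_rep D \<in> C" using assms class_rep_in by blast
  then have "C \<inter> D \<noteq> {}" using class_rep_in(1)[OF assms(2)] by blast
  then show ?thesis
    using quotient_disj[OF equiv_fin_ab_iso] assms(1,2) unfolding fin_ab_classes_def by blast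
qed

text \<open>It accepts a group over any type, such as a product of cyclic groups or a direct
  product, and moves it to the type over which the classes are formed.\<close>

definition iso_class :: "('a, 'm) monoid_scheme \<Rightarrow> nat monoid set" where
  "iso_class G = {H \<in> fin_ab_groups. G \<cong> H}"

lemma iso_class:
  assumes "comm_group G" "finite (carrier G)"
  shows "iso_class G \<in> fin_ab_classes" "class_rep (iso_class G) \<cong> G"
proof -
  have gr: "group G" using assms(1) by (simp add: comm_group.axioms)
  obtain H where H: "H \<in> fin_ab_groups" "G \<cong> H" using fin_ab_groups_complete[OF assms] by blast
  then have "H \<cong> G" using gr group.iso_sym by blast
  then have "iso_class G = fin_ab_iso `` {H}"
    using H by (auto simp: iso_class_def fin_ab_iso_def intro: iso_trans)
  then show "iso_class G \<in> fin_ab_classes"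
    using H(1) unfolding fin_ab_classes_def by (auto intro: quotientI)
  from class_rep_in(1)[OF this] have "G \<cong> class_rep (iso_class G)"
    unfolding iso_class_def by blast
  then show "class_rep (iso_class G) \<cong> G" using gr group.iso_sym by blast
qed

section \<open>Exponent bounds under isomorphism and direct products\<close>

lemma iso_card: "G \<cong> H \<Longrightarrow> card (carrier G) = card (carrier H)"
  by (auto simp: is_iso_def iso_def intro: bij_betw_same_card)

lemma exponent_bounded_iso_imp:
  assumes "G \<cong> H" "group G" "group H" "exponent_bounded r G"
  shows "exponent_bounded r H"
proof -
  obtain h where h: "h \<in> iso G H" using assms(1) by (auto simp: is_iso_def)
  then have "carrier H = h ` carrier G" by (simp add: iso_def bij_betw_def)
  then show ?thesis using iso_pow_eq_one_iff[OF h assms(2,3)] assms(4)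
    unfolding exponent_bounded_def by simp
qed

lemma exponent_bounded_iso:
  assumes "G \<cong> H" "group G" "group H"
  shows "exponent_bounded r G \<longleftrightarrow> exponent_bounded r H"
  using exponent_bounded_iso_imp[OF assms] exponent_bounded_iso_imp[of H G]
    group.iso_sym[OF assms(2,1)] assms(2,3) by blast

lemma DirProd_pow: "(x, y) [^]\<^bsub>G \<times>\<times> H\<^esub> (n::nat) = (x [^]\<^bsub>G\<^esub> n, y [^]\<^bsub>H\<^esub> n)"
  by (induction n) (auto simp: nat_pow_def)

lemma exponent_bounded_DirProd:
  assumes "group G" "group H"
  shows "exponent_bounded r (G \<times>\<times> H) \<longleftrightarrow> exponent_bounded r G \<and> exponent_bounded r H"
proof
  assume L: "exponent_bounded r (G \<times>\<times> H)"
  interpret G: group G by fact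
  interpret H: group H by fact
  have "(x, \<one>\<^bsub>H\<^esub>) [^]\<^bsub>G \<times>\<times> H\<^esub> (n::nat) = \<one>\<^bsub>G \<times>\<times> H\<^esub> \<longleftrightarrow> x [^]\<^bsub>G\<^esub> n = \<one>\<^bsub>G\<^esub>" for x n
    by (simp add: DirProd_pow)
  moreover have "(\<one>\<^bsub>G\<^esub>, y) [^]\<^bsub>G \<times>\<times> H\<^esub> (n::nat) = \<one>\<^bsub>G \<times>\<times> H\<^esub> \<longleftrightarrow> y [^]\<^bsub>H\<^esub> n = \<one>\<^bsub>H\<^esub>" for y n
    by (simp add: DirProd_pow)
  ultimately show "exponent_bounded r G \<and> exponent_bounded r H"
    using L unfolding exponent_bounded_def carrier_DirProd
    by (metis G.one_closed H.one_closed mem_Sigma_iff)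
next
  assume "exponent_bounded r G \<and> exponent_bounded r H"
  then show "exponent_bounded r (G \<times>\<times> H)"
    unfolding exponent_bounded_def by (auto simp: DirProd_pow) blast
qed

text \<open>A modulus p^a yields an element of order p^a, so a \<le> r is forced. Conversely, in the
  coordinate of a modulus q, a power of a prime l either meets a power of l, which divides l^r, or
  is coprime to q, so that q divides the coordinate already.\<close>

lemma exponent_bounded_cyclic_product:
  assumes qs: "\<forall>q\<in>set qs. primepow q"
  shows "exponent_bounded r (cyclic_product qs) \<longleftrightarrow> (\<forall>p a. prime p \<longrightarrow> p ^ a \<in> set qs \<longrightarrow> a \<le> r)"
proof
  note no0 = primepow_list_no_0[OF qs]
  assume L: "exponent_bounded r (cyclic_product qs)"
  show "\<forall>p a. prime p \<longrightarrow> p ^ a \<in> set qs \<longrightarrow> a \<le> r"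
  proof (intro allI impI)
    fix p a assume p: "prime p" and pa: "p ^ a \<in> set qs"
    then obtain i where i: "i < length qs" "qs ! i = p ^ a" by (auto simp: in_set_conv_nth)
    \<comment> \<open>The unit vector at position \<open>i\<close>, whose order is the modulus
      p^a.\<close>
    define x where "x = (\<lambda>j\<in>{..<length qs}. if j = i then 1 else (0::int))"
    have "qs ! j > 1" if "j < length qs" for j
      using qs that nth_mem primepow_gt_Suc_0 by fastforce
    then have "x \<in> carrier (cyclic_product qs)"
      unfolding carrier_cyclic_product[OF no0] x_def
      by (intro restrict_PiE_iff[THEN iffD2] ballI) force
    moreover have "x [^]\<^bsub>cyclic_product qs\<^esub> (p ^ a) = \<one>\<^bsub>cyclic_product qs\<^esub>"
      unfolding cyclic_product_pow_eq_one_iff[OF no0] using i by (auto simp: x_def)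
    ultimately have "x [^]\<^bsub>cyclic_product qs\<^esub> (p ^ r) = \<one>\<^bsub>cyclic_product qs\<^esub>"
      using L p unfolding exponent_bounded_def by blast
    then have "int (qs ! i) dvd int (p ^ r) * x i"
      unfolding cyclic_product_pow_eq_one_iff[OF no0] using i(1) by blast
    then have "p ^ a dvd p ^ r"
      using i by (simp add: x_def del: of_nat_power)
    then show "a \<le> r" using power_dvd_imp_le prime_gt_1_nat[OF p] by blast
  qed
next
  note no0 = primepow_list_no_0[OF qs]
  assume R: "\<forall>p a. prime p \<longrightarrow> p ^ a \<in> set qs \<longrightarrow> a \<le> r"
  have step: "int q dvd int (l ^ r) * y"
    if q: "q \<in> set qs" and l: "prime l" and d: "int q dvd int (l ^ k) * y" for q l k y
  proof -
    obtain p a where p: "prime p" "q = p ^ a" using qs q by (auto simp: primepow_def)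
    show ?thesis
    proof (cases "p = l")
      case True
      have "a \<le> r" using R p q by blast
      then have "q dvd l ^ r" using p True by (simp add: le_imp_power_dvd)
      then show ?thesis by (intro dvd_mult2) (simp only: of_nat_dvd_iff)
    next
      case False
      then have "coprime q (l ^ k)" using p l by (simp add: primes_coprime)
      then have "int q dvd y" using d
        by (metis coprime_dvd_mult_right_iff coprime_int_iff)
      then show ?thesis by simp
    qed
  qed
  show "exponent_bounded r (cyclic_product qs)"
    unfolding exponent_bounded_def cyclic_product_pow_eq_one_iff[OF no0]
    using step nth_mem by blast
qed

text \<open>
  The multiplicity of \<open>p\<close> in the \<open>k\<close>-th entry, counted from 0, is the number of summands
  \<open>Z/p^(k+1)\<close>.
\<close>

definition type_mset :: "nat list \<Rightarrow> nat multiset" where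
  "type_mset ns = (\<Sum>k<length ns. image_mset (\<lambda>p. p ^ Suc k) (prime_factorization (ns ! k)))"

lemma mem_type_mset:
  assumes "q \<in># type_mset ns"
  obtains p k where "prime p" "k < length ns" "q = p ^ Suc k"
proof -
  have "set_mset (type_mset ns) =
      (\<Union>k<length ns. set_mset (image_mset (\<lambda>p. p ^ Suc k) (prime_factorization (ns ! k))))"
    unfolding type_mset_def by (rule set_mset_sum) simp
  with assms obtain k p where "k < length ns" "p \<in> prime_factors (ns ! k)" "q = p ^ Suc k" by auto
  then show ?thesis using that by blast
qed

text \<open>A prime power determines its prime and its exponent, so p^(k+1) can only come from the
  k-th entry.\<close>

lemma count_type_mset:
  assumes p: "prime p" and k: "k < length ns"
  shows "count (type_mset ns) (p ^ Suc k) = multiplicity p (ns ! k)"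
proof -
  have "count (image_mset (\<lambda>p. p ^ Suc j) (prime_factorization (ns ! j))) (p ^ Suc k)
      = (if j = k then multiplicity p (ns ! k) else 0)" for j
  proof (cases "j = k")
    case True
    have "p ^ Suc k = l ^ Suc k \<longleftrightarrow> p = l" for p l :: nat
      by (rule power_eq_iff_eq_base) simp_all
    then have "count (image_mset (\<lambda>p. p ^ Suc k) P) (p ^ Suc k) = count P p" for P
      by (induction P) simp_all
    then have "count (image_mset (\<lambda>p. p ^ Suc k) (prime_factorization (ns ! k))) (p ^ Suc k)
        = count (prime_factorization (ns ! k)) p"
      .
    then show ?thesis using True p by (simp add: count_prime_factorization_prime)
  next
    case False
    have "p ^ Suc k \<notin># image_mset (\<lambda>p. p ^ Suc j) (prime_factorization (ns ! j))"
    proof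
      assume "p ^ Suc k \<in># image_mset (\<lambda>p. p ^ Suc j) (prime_factorization (ns ! j))"
      then obtain l where "prime l" "p ^ Suc k = l ^ Suc j" by auto
      then have "Suc k = Suc j" using prime_power_inj'[of p l "Suc k" "Suc j"] p by blast
      then show False using False by simp
    qed
    then show ?thesis using False by (metis not_in_iff)
  qed
  then show ?thesis using k by (simp add: type_mset_def count_sum)
qed

text \<open>The product of the moduli is the order of the group; this identifies the order with the
  weight used in the count.\<close>

lemma prod_mset_type_mset:
  assumes "ns \<in> pos_lists r"
  shows "prod_mset (type_mset ns) = list_weight ns"
proof -
  have pw: "prod_mset (image_mset (\<lambda>p. p ^ m) M) = prod_mset M ^ m" for M :: "nat multiset" and m
    by (induction M) (auto simp: power_mult_distrib)
  have sm: "prod_mset (\<Sum>k\<in>A. f k) = (\<Prod>k\<in>A. prod_mset (f k))" if "finite A" for f :: "nat \<Rightarrow> nat multiset" and A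
    using that by (induction A rule: finite_induct) auto
  have "prod_mset (type_mset ns) = (\<Prod>k<length ns. prod_mset (prime_factorization (ns ! k)) ^ Suc k)"
    unfolding type_mset_def by (simp only: sm finite_lessThan pw)
  also have "\<dots> = list_weight ns"
    unfolding list_weight_def
  proof (rule prod.cong)
    fix k assume "k \<in> {..<length ns}"
    then have "ns ! k > 0" using assms by (auto simp: pos_lists_def)
    then show "prod_mset (prime_factorization (ns ! k)) ^ Suc k = (ns ! k) ^ Suc k"
      by (simp add: prod_mset_prime_factorization_nat)
  qed simp
  finally show ?thesis .
qed

lemma type_mset_inj:
  assumes "ns \<in> pos_lists r" "ms \<in> pos_lists r" "type_mset ns = type_mset ms"
  shows "ns = ms"
proof (rule nth_equalityI)
  show "length ns = length ms" using assms by (simp add: pos_lists_def)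
  fix k assume k: "k < length ns"
  then have k': "k < length ms" using assms by (simp add: pos_lists_def)
  show "ns ! k = ms ! k"
  proof (rule multiplicity_eq_nat)
    show "ns ! k > 0" "ms ! k > 0" using assms k k' by (auto simp: pos_lists_def)
    fix p :: nat assume "prime p"
    then show "multiplicity p (ns ! k) = multiplicity p (ms ! k)"
      using count_type_mset[of p k ns] count_type_mset[of p k ms] k k' assms(3) by simp
  qed
qed

text \<open>The k-th entry is the product of the bases of all (k+1)-th prime powers in
  \<open>M\<close>; its prime factorization returns exactly these bases.\<close>

lemma type_mset_surj:
  assumes M: "\<And>q. q \<in># M \<Longrightarrow> \<exists>p k. prime p \<and> k < r \<and> q = p ^ Suc k"
  shows "\<exists>ns\<in>pos_lists r. type_mset ns = M"
proof -
  \<comment> \<open>\<open>aprimedivisor\<close> recovers p from p^(k+1). So \<open>F k\<close>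
    collects the members of \<open>M\<close> with exponent k + 1, and each member lies in exactly
    one \<open>F k\<close>.\<close>
  define F where "F = (\<lambda>k. filter_mset (\<lambda>q. q = aprimedivisor q ^ Suc k) M)"
  define ns where "ns = map (\<lambda>k. prod_mset (image_mset aprimedivisor (F k))) [0..<r]"
  have ap: "aprimedivisor (p ^ Suc k) = p" if "prime p" for p k :: nat
    using that by (intro aprimedivisor_prime_power) auto
  have prm: "prime (aprimedivisor q)" if "q \<in># F k" for q k
    using that M[of q] ap unfolding F_def by auto
  have len: "length ns = r" by (simp add: ns_def)
  have nth: "ns ! k = prod_mset (image_mset aprimedivisor (F k))" if "k < r" for k
    using that by (simp add: ns_def)
  have "image_mset (\<lambda>p. p ^ Suc k) (prime_factorization (ns ! k)) = F k" if "k < r" for k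
  proof -
    have "prime_factorization (ns ! k) = image_mset aprimedivisor (F k)"
      unfolding nth[OF that] by (rule prime_factorization_prod_mset_primes) (use prm in auto)
    then have "image_mset (\<lambda>p. p ^ Suc k) (prime_factorization (ns ! k)) =
        image_mset (\<lambda>q. aprimedivisor q ^ Suc k) (F k)"
      by (simp add: multiset.map_comp comp_def)
    also have "\<dots> = image_mset (\<lambda>q. q) (F k)"
      by (rule image_mset_cong) (auto simp: F_def)
    finally show ?thesis by simp
  qed
  then have "type_mset ns = (\<Sum>k<r. F k)" unfolding type_mset_def len by (intro sum.cong) auto
  also have "\<dots> = M"
  proof (rule multiset_eqI)
    fix q
    show "count (\<Sum>k<r. F k) q = count M q"
    proof (cases "q \<in># M")
      case True
      then obtain p j where q: "prime p" "j < r" "q = p ^ Suc j" using M by blast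
      have "q = aprimedivisor q ^ Suc k \<longleftrightarrow> k = j" for k
        unfolding q(3) ap[OF q(1)] using prime_gt_1_nat[OF q(1)] by (simp only: power_inject_exp) auto
      then have "count (F k) q = (if k = j then count M q else 0)" for k
        unfolding F_def by simp
      then show ?thesis using q(2) by (simp add: count_sum)
    next
      case False
      then show ?thesis by (simp add: count_sum F_def not_in_iff)
    qed
  qed
  finally have "type_mset ns = M" .
  moreover have "ns \<in> pos_lists r"
  proof -
    have "n > 0" if "n \<in> set ns" for n
    proof -
      obtain k where "n = prod_mset (image_mset aprimedivisor (F k))" using \<open>n \<in> set ns\<close> by (auto simp: ns_def)
      moreover have "0 \<notin># image_mset aprimedivisor (F k)" using prm by (metis image_iff not_prime_0 set_image_mset)
      ultimately show ?thesis by (metis gr0I prod_mset_zero_iff)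
    qed
    then show ?thesis by (simp add: pos_lists_def len)
  qed
  ultimately show ?thesis by blast
qed

section \<open>The bijection between tuples and classes of bounded exponent\<close>

definition bounded_classes :: "nat \<Rightarrow> nat monoid set set" where
  "bounded_classes r = {C \<in> fin_ab_classes. exponent_bounded r (class_rep C)}"

definition class_of_list :: "nat list \<Rightarrow> nat monoid set" where
  "class_of_list ns = iso_class (cyclic_product (sorted_list_of_multiset (type_mset ns)))"

lemma class_of_list:
  assumes ns: "ns \<in> pos_lists r"
  defines "qs \<equiv> sorted_list_of_multiset (type_mset ns)"
  shows "mset qs = type_mset ns" "\<forall>q\<in>set qs. primepow q" "class_of_list ns \<in> bounded_classes r"
    "class_rep (class_of_list ns) \<cong> cyclic_product qs"
    "card (carrier (class_rep (class_of_list ns))) = list_weight ns"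
proof -
  show qs: "mset qs = type_mset ns" by (simp add: qs_def)
  have mem: "\<exists>p k. prime p \<and> k < r \<and> q = p ^ Suc k" if "q \<in> set qs" for q
  proof -
    have "q \<in># type_mset ns" using that qs by (metis set_mset_mset)
    then show ?thesis using ns by (elim mem_type_mset) (auto simp: pos_lists_def)
  qed
  show pp: "\<forall>q\<in>set qs. primepow q"
    using mem by (auto simp: primepow_prime_power simp del: power_Suc dest!: mem)
  note no0 = primepow_list_no_0[OF pp]
  note ic = iso_class[OF comm_group_cyclic_product finite_cyclic_product[OF no0]]
  show iso: "class_rep (class_of_list ns) \<cong> cyclic_product qs"
    unfolding class_of_list_def qs_def[symmetric] by (rule ic)
  have cls: "class_of_list ns \<in> fin_ab_classes"
    unfolding class_of_list_def qs_def[symmetric] by (rule ic)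
  have "exponent_bounded r (cyclic_product qs)"
    unfolding exponent_bounded_cyclic_product[OF pp]
  proof (intro allI impI)
    fix p a assume p: "prime p" and "p ^ a \<in> set qs"
    then obtain l k where l: "prime l" "k < r" "p ^ a = l ^ Suc k" using mem by blast
    have "a \<noteq> 0"
    proof
      assume "a = 0"
      then show False using l one_less_power[of l "Suc k"] prime_gt_1_nat[OF l(1)] by simp
    qed
    then have "a = Suc k" using prime_power_inj'[of p l a "Suc k"] p l by simp
    then show "a \<le> r" using l(2) by simp
  qed
  then have "exponent_bounded r (class_rep (class_of_list ns))"
    using exponent_bounded_iso[OF iso] fin_ab_groupsD(2)[OF class_rep_in(2)[OF cls]] by simp
  then show "class_of_list ns \<in> bounded_classes r" using cls by (simp add: bounded_classes_def)
  show "card (carrier (class_rep (class_of_list ns))) = list_weight ns"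
    unfolding iso_card[OF iso] card_cyclic_product[OF no0]
    using prod_mset_type_mset[OF ns] qs by (metis prod_mset_prod_list)
qed

text \<open>Injectivity is the uniqueness of the moduli, surjectivity the structure theorem; the
  bound on the exponent confines the moduli to those that a list of length r can encode.\<close>

lemma bij_betw_class_of_list: "bij_betw class_of_list (pos_lists r) (bounded_classes r)"
proof (rule bij_betw_imageI)
  show "inj_on class_of_list (pos_lists r)"
  proof (rule inj_onI)
    fix ns ms assume ns: "ns \<in> pos_lists r" and ms: "ms \<in> pos_lists r"
      and eq: "class_of_list ns = class_of_list ms"
    note n = class_of_list[OF ns] and m = class_of_list[OF ms]
    have "class_of_list ns \<in> fin_ab_classes" using n(3) by (simp add: bounded_classes_def)
    then have "group (class_rep (class_of_list ns))" using class_rep_in(2) fin_ab_groupsD(2) by blast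
    then have "cyclic_product (sorted_list_of_multiset (type_mset ns)) \<cong> class_rep (class_of_list ns)"
      using group.iso_sym n(4) by blast
    also have "\<dots> \<cong> cyclic_product (sorted_list_of_multiset (type_mset ms))"
      unfolding eq by (rule m(4))
    finally have "type_mset ns = type_mset ms"
      using cyclic_product_iso_imp_mset_eq[OF n(2) m(2)] n(1) m(1) by simp
    then show "ns = ms" by (rule type_mset_inj[OF ns ms])
  qed
  show "class_of_list ` pos_lists r = bounded_classes r"
  proof (intro equalityI subsetI)
    fix C assume "C \<in> class_of_list ` pos_lists r"
    then show "C \<in> bounded_classes r" using class_of_list(3) by blast
  next
    fix C assume "C \<in> bounded_classes r"
    then have C: "C \<in> fin_ab_classes" "exponent_bounded r (class_rep C)"
      by (auto simp: bounded_classes_def)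
    note rep = fin_ab_groupsD[OF class_rep_in(2)[OF C(1)]]
    obtain qs where qs: "\<forall>q\<in>set qs. primepow q" "class_rep C \<cong> cyclic_product qs"
      using finite_comm_group_iso_cyclic_product[OF rep(1,3)] by blast
    have bd: "exponent_bounded r (cyclic_product qs)"
      using exponent_bounded_iso[OF qs(2) rep(2) group_cyclic_product] C(2) by simp
    have "\<exists>p k. prime p \<and> k < r \<and> q = p ^ Suc k" if q: "q \<in># mset qs" for q
    proof -
      obtain p a where p: "prime p" "a > 0" "q = p ^ a"
        using qs(1) q by (auto simp: primepow_def)
      then have "a \<le> r" using bd q unfolding exponent_bounded_cyclic_product[OF qs(1)] by auto
      \<comment> \<open>The exponent a belongs to list position a - 1.\<close>
      then show ?thesis using p by (intro exI[of _ p] exI[of _ "a - 1"]) auto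
    qed
    then obtain ns where ns: "ns \<in> pos_lists r" "type_mset ns = mset qs"
      using type_mset_surj[of "mset qs" r] by blast
    note n = class_of_list[OF ns(1)]
    have cn: "class_of_list ns \<in> fin_ab_classes" using n(3) by (simp add: bounded_classes_def)
    have "class_rep (class_of_list ns) \<cong> cyclic_product qs"
      by (rule iso_trans[OF n(4) cyclic_product_perm]) (simp add: ns(2))
    moreover have "cyclic_product qs \<cong> class_rep C" using qs(2) rep(2) group.iso_sym by blast
    ultimately have "class_rep (class_of_list ns) \<cong> class_rep C" by (rule iso_trans)
    then have "class_of_list ns = C" by (rule class_eqI[OF cn C(1)])
    then show "C \<in> class_of_list ` pos_lists r" using ns(1) by blast
  qed
qed

section \<open>Pairs of direct factors\<close>

definition class_order :: "nat monoid set \<Rightarrow> nat" where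
  "class_order C = card (carrier (class_rep C))"

lemma xlogx_count_bounded_classes:
  assumes "r \<ge> 1"
  shows "\<exists>c>0. xlogx_count (bounded_classes r \<times> bounded_classes r)
           (\<lambda>(D, E). class_order D * class_order E) c"
proof -
  obtain r' where r: "r = Suc r'" using assms by (cases r) auto
  obtain c where c: "c > 0" "xlogx_count (pos_lists r \<times> pos_lists r)
      (\<lambda>(ns, ms). list_weight ns * list_weight ms) c"
    using xlogx_count_pos_lists[of r'] unfolding r by blast
  define f where "f = inv_into (pos_lists r) class_of_list"
  have f: "bij_betw f (bounded_classes r) (pos_lists r)"
    unfolding f_def using bij_betw_class_of_list by (rule bij_betw_inv_into)
  have ord: "class_order C = list_weight (f C)" if "C \<in> bounded_classes r" for C
  proof -
    have "f C \<in> pos_lists r" using f that by (auto simp: bij_betw_def)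
    moreover have "class_of_list (f C) = C"
      using bij_betw_class_of_list that unfolding f_def by (rule bij_betw_inv_into_right)
    ultimately show ?thesis using class_of_list(5) by (metis class_order_def)
  qed
  have "bij_betw (map_prod f f) (bounded_classes r \<times> bounded_classes r) (pos_lists r \<times> pos_lists r)"
    using f f by (rule bij_betw_map_prod)
  then have "xlogx_count (bounded_classes r \<times> bounded_classes r)
      (\<lambda>(D, E). class_order D * class_order E) c"
    by (rule xlogx_count_bij[OF c(2)]) (auto simp: ord)
  with c(1) show ?thesis by blast
qed

lemma comm_group_DirProd:
  assumes "comm_group G" "comm_group H"
  shows "comm_group (G \<times>\<times> H)"
proof (rule group.group_comm_groupI)
  interpret G: comm_group G by fact
  interpret H: comm_group H by fact
  show "group (G \<times>\<times> H)" by (intro DirProd_group) unfold_locales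
  fix x y assume "x \<in> carrier (G \<times>\<times> H)" "y \<in> carrier (G \<times>\<times> H)"
  then show "x \<otimes>\<^bsub>G \<times>\<times> H\<^esub> y = y \<otimes>\<^bsub>G \<times>\<times> H\<^esub> x"
    by (auto simp: G.m_comm H.m_comm)
qed

definition factor_pairs :: "nat monoid set \<Rightarrow> (nat monoid set \<times> nat monoid set) set" where
  "factor_pairs C = {(D, E). D \<in> fin_ab_classes \<and> E \<in> fin_ab_classes \<and>
     class_rep C \<cong> class_rep D \<times>\<times> class_rep E}"

text \<open>Direct products respect isomorphism, so the witnesses in the two classes can be replaced
  by the representatives.\<close>

lemma num_direct_factors_eq: "num_direct_factors (class_rep C) = card (factor_pairs C)"
proof -
  have "(\<exists>H\<in>D. \<exists>K\<in>E. class_rep C \<cong> H \<times>\<times> K) \<longleftrightarrow> class_rep C \<cong> class_rep D \<times>\<times> class_rep E"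
    if D: "D \<in> fin_ab_classes" and E: "E \<in> fin_ab_classes" for D E
  proof
    assume "\<exists>H\<in>D. \<exists>K\<in>E. class_rep C \<cong> H \<times>\<times> K"
    then obtain H K where H: "H \<in> D" and K: "K \<in> E" and i: "class_rep C \<cong> H \<times>\<times> K" by blast
    have "H \<cong> class_rep D" "K \<cong> class_rep E"
      using class_rep_in(2,3)[OF D] class_rep_in(2,3)[OF E] H K fin_ab_groupsD(2) group.iso_sym by metis+
    then have "H \<times>\<times> K \<cong> class_rep D \<times>\<times> class_rep E" by (rule DirProd_iso_cong)
    with i show "class_rep C \<cong> class_rep D \<times>\<times> class_rep E" by (rule iso_trans)
  next
    assume "class_rep C \<cong> class_rep D \<times>\<times> class_rep E"
    then show "\<exists>H\<in>D. \<exists>K\<in>E. class_rep C \<cong> H \<times>\<times> K"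
      using class_rep_in(1)[OF D] class_rep_in(1)[OF E] by blast
  qed
  then have "{(D, E). D \<in> fin_ab_classes \<and> E \<in> fin_ab_classes \<and> (\<exists>H\<in>D. \<exists>K\<in>E. class_rep C \<cong> H \<times>\<times> K)}
      = factor_pairs C"
    unfolding factor_pairs_def by blast
  then show ?thesis by (simp add: num_direct_factors_def)
qed

lemma factor_pairs_bounded:
  assumes C: "C \<in> fin_ab_classes" and DE: "(D, E) \<in> factor_pairs C"
  shows "C \<in> bounded_classes r \<longleftrightarrow> D \<in> bounded_classes r \<and> E \<in> bounded_classes r"
    "class_order C = class_order D * class_order E"
proof -
  have cl: "D \<in> fin_ab_classes" "E \<in> fin_ab_classes"
    and iso: "class_rep C \<cong> class_rep D \<times>\<times> class_rep E"
    using DE by (auto simp: factor_pairs_def)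
  have gr: "group (class_rep C)" "group (class_rep D)" "group (class_rep E)"
    using C cl class_rep_in(2) fin_ab_groupsD(2) by blast+
  show "C \<in> bounded_classes r \<longleftrightarrow> D \<in> bounded_classes r \<and> E \<in> bounded_classes r"
    using exponent_bounded_iso[OF iso gr(1) DirProd_group[OF gr(2,3)]]
      exponent_bounded_DirProd[OF gr(2,3)] C cl by (simp add: bounded_classes_def)
  show "class_order C = class_order D * class_order E"
    using iso_card[OF iso] by (simp add: class_order_def card_cartesian_product)
qed

text \<open>Every pair counted on the right belongs to \<open>factor_pairs C\<close> for exactly one
  class C, that of its direct product. The sets \<open>factor_pairs C\<close> thus partition the
  pairs, and multiplicativity of the order matches the two size conditions.\<close>

lemma sum_num_direct_factors:
  fixes x :: real
  assumes fin: "\<And>x::real. finite {q \<in> bounded_classes r \<times> bounded_classes r.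
      real ((\<lambda>(D, E). class_order D * class_order E) q) \<le> x}"
  shows "(\<Sum>C | C \<in> bounded_classes r \<and> real (class_order C) \<le> x. num_direct_factors (class_rep C))
    = card {q \<in> bounded_classes r \<times> bounded_classes r.
        real ((\<lambda>(D, E). class_order D * class_order E) q) \<le> x}"
proof -
  define W where "W = (\<lambda>x::real. {q \<in> bounded_classes r \<times> bounded_classes r.
      real ((\<lambda>(D, E). class_order D * class_order E) q) \<le> x})"
  define A where "A = {C. C \<in> bounded_classes r \<and> real (class_order C) \<le> x}"
  have cls: "C \<in> fin_ab_classes" if "C \<in> bounded_classes r" for C
    using that by (simp add: bounded_classes_def)
  \<comment> \<open>Finiteness of \<open>A\<close> comes from the diagonal pairs \<open>(C, C)\<close>.\<close>
  have "A \<subseteq> fst ` W (x * x)"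
  proof
    fix C assume C: "C \<in> A"
    then have "real (class_order C) * real (class_order C) \<le> x * x"
      by (intro mult_mono) (auto simp: A_def intro: order_trans[of 0])
    then have "(C, C) \<in> W (x * x)" using C by (simp add: W_def A_def)
    then show "C \<in> fst ` W (x * x)" by force
  qed
  moreover have finW: "finite (W y)" for y using fin by (simp add: W_def)
  ultimately have finA: "finite A" by (meson finite_imageI finite_subset)
  have sub: "factor_pairs C \<subseteq> W x" if "C \<in> A" for C
  proof
    fix q assume q: "q \<in> factor_pairs C"
    obtain D E where de: "q = (D, E)" by (cases q)
    have C: "C \<in> bounded_classes r" "real (class_order C) \<le> x" using that by (auto simp: A_def)
    from factor_pairs_bounded[OF cls[OF C(1)] q[unfolded de]] C show "q \<in> W x"
      by (simp add: W_def de)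
  qed
  have "bij_betw snd (Sigma A factor_pairs) (W x)"
  proof (rule bij_betw_imageI)
    show "inj_on snd (Sigma A factor_pairs)"
    proof (rule inj_onI)
      fix u v assume uv: "u \<in> Sigma A factor_pairs" "v \<in> Sigma A factor_pairs" "snd u = snd v"
      obtain C D E where u: "u = (C, (D, E))" by (cases u) auto
      obtain C' where v: "v = (C', (D, E))" using uv u by (cases v) auto
      have C: "C \<in> fin_ab_classes" "C' \<in> fin_ab_classes"
        using uv u v cls by (auto simp: A_def)
      have "class_rep C \<cong> class_rep D \<times>\<times> class_rep E" "class_rep C' \<cong> class_rep D \<times>\<times> class_rep E"
        using uv u v by (auto simp: factor_pairs_def)
      then have "class_rep C \<cong> class_rep C'"
        using C class_rep_in(2) fin_ab_groupsD(2) group.iso_sym iso_trans by metis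
      then have "C = C'" by (rule class_eqI[OF C])
      then show "u = v" by (simp add: u v)
    qed
    show "snd ` Sigma A factor_pairs = W x"
    proof (intro equalityI subsetI)
      fix q assume "q \<in> snd ` Sigma A factor_pairs"
      then obtain C where "C \<in> A" "q \<in> factor_pairs C" by auto
      then show "q \<in> W x" using sub by blast
    next
      fix q assume q: "q \<in> W x"
      then obtain D E where de: "q = (D, E)" "D \<in> bounded_classes r" "E \<in> bounded_classes r"
        "real (class_order D * class_order E) \<le> x" by (auto simp: W_def)
      note rD = fin_ab_groupsD[OF class_rep_in(2)[OF cls[OF de(2)]]]
      note rE = fin_ab_groupsD[OF class_rep_in(2)[OF cls[OF de(3)]]]
      let ?P = "class_rep D \<times>\<times> class_rep E"
      have P: "comm_group ?P" "finite (carrier ?P)"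
        using comm_group_DirProd[OF rD(1) rE(1)] rD(3) rE(3) by auto
      \<comment> \<open>The direct product lives on pairs of numbers; its class over the natural
        numbers is the preimage of (D, E).\<close>
      note C = iso_class[OF P]
      have f: "(D, E) \<in> factor_pairs (iso_class ?P)"
        using C(2) cls de by (simp add: factor_pairs_def)
      from factor_pairs_bounded(1)[OF C(1) f, of r] factor_pairs_bounded(2)[OF C(1) f] have "iso_class ?P \<in> A"
        using de by (simp add: A_def)
      with f have "(iso_class ?P, q) \<in> Sigma A factor_pairs" by (simp add: de)
      then show "q \<in> snd ` Sigma A factor_pairs" by force
    qed
  qed
  then have "card (Sigma A factor_pairs) = card (W x)" by (rule bij_betw_same_card)
  moreover have "card (Sigma A factor_pairs) = (\<Sum>C\<in>A. card (factor_pairs C))"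
    using finA sub finW by (intro card_SigmaI) (auto intro: finite_subset)
  ultimately show ?thesis by (simp add: num_direct_factors_eq A_def W_def)
qed

theorem corollary1:
  fixes r :: nat
  assumes "r \<ge> 1"
  shows "\<exists>A :: real.
    (\<lambda>x :: real. \<Sum>C | C \<in> fin_ab_classes \<and>
                       real (card (carrier (class_rep C))) \<le> x \<and>
                       group_rank (conjugate_group (class_rep C)) \<le> r.
                   real (num_direct_factors (class_rep C)))
      \<sim>[at_top] (\<lambda>x. A * x * ln x)"
proof -
  let ?W = "\<lambda>x::real. {q \<in> bounded_classes r \<times> bounded_classes r.
      real ((\<lambda>(D, E). class_order D * class_order E) q) \<le> x}"
  obtain c where c: "c > 0" "xlogx_count (bounded_classes r \<times> bounded_classes r)
      (\<lambda>(D, E). class_order D * class_order E) c"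
    using xlogx_count_bounded_classes[OF assms] by blast
  have index: "{C. C \<in> fin_ab_classes \<and> real (card (carrier (class_rep C))) \<le> x \<and>
        group_rank (conjugate_group (class_rep C)) \<le> r}
      = {C. C \<in> bounded_classes r \<and> real (class_order C) \<le> x}" for x
  proof -
    have "group_rank (conjugate_group (class_rep C)) \<le> r \<longleftrightarrow> exponent_bounded r (class_rep C)"
      if "C \<in> fin_ab_classes" for C
      using fin_ab_groupsD[OF class_rep_in(2)[OF that]] by (intro group_rank_conjugate_le_iff)
    then show ?thesis by (auto simp: bounded_classes_def class_order_def)
  qed
  have sum: "(\<Sum>C | C \<in> fin_ab_classes \<and> real (card (carrier (class_rep C))) \<le> x \<and>
        group_rank (conjugate_group (class_rep C)) \<le> r. real (num_direct_factors (class_rep C)))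
      = real (card (?W x))" for x
    unfolding index sum_num_direct_factors[OF xlogx_countD(2)[OF c(2)], of x, symmetric] by simp
  \<comment> \<open>The quotient has to tend to 1, so the limit is divided by \<open>c\<close>; this
    is where the positivity carried through the induction enters.\<close>
  have "((\<lambda>x. (real (card (?W x)) / (x * ln x)) / c) \<longlongrightarrow> c / c) at_top"
    using xlogx_countD(3)[OF c(2)] by (rule tendsto_divide) (use c in auto)
  then have "((\<lambda>x. real (card (?W x)) / (c * x * ln x)) \<longlongrightarrow> 1) at_top"
    using c(1) by (simp add: mult_ac)
  then have "(\<lambda>x. real (card (?W x))) \<sim>[at_top] (\<lambda>x. c * x * ln x)"
    by (rule asymp_equivI')
  then show ?thesis unfolding sum by blast
qed

end
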